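(* Deciding whether a given $\mathrm{Reachability}$ or $\mathrm{Safety}$ automaton $\mathcal A$ on finite words is history-deterministic can be done in time cubic in the size of $\mathcal A$.
   Context: **Automata.** A (nondeterministic quantitative) automaton is a tuple $\mathcal A=(\Sigma,Q,\iota,\delta)$ with $\Sigma$ a finite nonempty alphabet, $Q$ a finite nonempty set of states, $\iota\in Q$ the initial state, and $\delta:Q\times\Sigma\to 2^{\mathbb Q\times Q}$ a transition function whose values are finite and nonempty (the automaton is total). If $(x,q')\in\delta(q,\sigma)$ we write $q\xrightarrow{\sigma:x}q'$ for this transition, of weight $x$. A run on a finite word $w=\sigma_0\ldots\sigma_l$ is a sequence of transitions $q_0\xrightarrow{\sigma_0:x_0}q_1\xrightarrow{\sigma_1:x_1}\ldots$ over $w$ with $q_0=\iota$. The size of an automaton is the maximum among the sizes of its alphabet, its state-space and its transition-space. A $\mathrm{Reachability}$ automaton has weights in $\{0,1\}$ and value function $\mathrm{Val}=\sup$ of the weight sequence, and every transition of weight $1$ leads to a sink (the target) all of whose outgoing transitions are self-loops of weight $1$. A $\mathrm{Safety}$ automaton has weights in $\{0,1\}$ and value function $\mathrm{Val}=\inf$ of the weight sequence, and every transition of weight $0$ leads to a sink all of whose outgoing transitions are self-loops of weight $0$. The value $\mathrm{Val}(\rho)$ of a run $\rho$ is the value function applied to its weight sequence, and $\mathcal A(w)$ is the supremum of the values of all runs of $\mathcal A$ on $w$. **Letter game and history-determinism.** A play of the letter game on $\mathcal A$ starts in $q_0=\iota$; in turn $i=0,1,\ldots$, from state $q_i$, Adam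 picks a letter $\sigma_i\in\Sigma$ and then Eve picks a transition $t_i=q_i\xrightarrow{\sigma_i:x_i}q_{i+1}$. For $\mathcal A$ on finite words, Eve wins the (infinite) play if for all $i\in\mathbb N$, $\mathrm{Val}(t_0\ldots t_i)\ge\mathcal A(\sigma_0\ldots\sigma_i)$. $\mathcal A$ is history-deterministic (HD) if Eve has a winning strategy in the letter game. *)

theory Defs
  imports Complex_Main
begin

section \<open>Quantitative automata\<close>

record ('a, 's) automaton =
  alphabet :: "'a set"
  states :: "'s set"
  init :: 's
  delta :: "'s \<Rightarrow> 'a \<Rightarrow> (rat \<times> 's) set"

definition automaton :: "('a, 's) automaton \<Rightarrow> bool" where
  "automaton A \<longleftrightarrow>
     finite (alphabet A) \<and> alphabet A \<noteq> {} \<and> finite (states A) \<and> init A \<in> states A \<and>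
     (\<forall>q\<in>states A. \<forall>a\<in>alphabet A.
        finite (delta A q a) \<and> delta A q a \<noteq> {} \<and> (\<forall>(x, q')\<in>delta A q a. q' \<in> states A))"

datatype ('a, 's) transition =
  Transition (source: 's) (letter: 'a) (weight: rat) (target: 's)

definition transitions :: "('a, 's) automaton \<Rightarrow> ('a, 's) transition set" where
  "transitions A =
     {Transition q a x q' | q a x q'. q \<in> states A \<and> a \<in> alphabet A \<and> (x, q') \<in> delta A q a}"

definition automaton_size :: "('a, 's) automaton \<Rightarrow> nat" where
  "automaton_size A =
     max (card (alphabet A)) (max (card (states A)) (card (transitions A)))"

definition is_run :: "('a, 's) automaton \<Rightarrow> 'a list \<Rightarrow> ('a, 's) transition list \<Rightarrow> bool" where
  "is_run A w \<rho> \<longleftrightarrow>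
     length \<rho> = length w \<and>
     (\<forall>i<length w. \<rho> ! i \<in> transitions A \<and> letter (\<rho> ! i) = w ! i \<and>
        source (\<rho> ! i) = (if i = 0 then init A else target (\<rho> ! (i - 1))))"

text \<open>A value function is applied only to nonempty weight sequences.\<close>

type_synonym value_function = "rat list \<Rightarrow> real"

definition sup_value :: value_function where
  "sup_value xs = Sup (real_of_rat ` set xs)"

definition inf_value :: value_function where
  "inf_value xs = Inf (real_of_rat ` set xs)"

definition run_value :: "value_function \<Rightarrow> ('a, 's) transition list \<Rightarrow> real" where
  "run_value Val \<rho> = Val (map weight \<rho>)"

definition word_value :: "value_function \<Rightarrow> ('a, 's) automaton \<Rightarrow> 'a list \<Rightarrow> real" where
  "word_value Val A w = (SUP \<rho>\<in>{\<rho>. is_run A w \<rho>}. run_value Val \<rho>)"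

text \<open>
  The parameter \<open>b\<close> is the absorbing weight: the weight of a transition that must lead
  to a sink, and of the self-loops on that sink.
\<close>

definition absorbing_automaton :: "rat \<Rightarrow> ('a, 's) automaton \<Rightarrow> bool" where
  "absorbing_automaton b A \<longleftrightarrow>
     automaton A \<and>
     (\<forall>t\<in>transitions A. weight t \<in> {0, 1}) \<and>
     (\<forall>t\<in>transitions A. weight t = b \<longrightarrow>
        (\<forall>u\<in>transitions A. source u = target t \<longrightarrow> target u = target t \<and> weight u = b))"

text \<open>Reachability automata are used with \<open>sup_value\<close>, safety automata with \<open>inf_value\<close>.\<close>

definition reachability_automaton :: "('a, 's) automaton \<Rightarrow> bool" where
  "reachability_automaton A \<longleftrightarrow> absorbing_automaton 1 A"

definition safety_automaton :: "('a, 's) automaton \<Rightarrow> bool" where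
  "safety_automaton A \<longleftrightarrow> absorbing_automaton 0 A"


section \<open>The letter game on finite words\<close>

text \<open>
  A strategy of Eve maps the transitions taken so far (which carry the letters played so
  far) and the letter just played by Adam to her next transition.
\<close>

type_synonym ('a, 's) strategy = "('a, 's) transition list \<Rightarrow> 'a \<Rightarrow> ('a, 's) transition"

primrec play_prefix :: "('a, 's) strategy \<Rightarrow> (nat \<Rightarrow> 'a) \<Rightarrow> nat \<Rightarrow> ('a, 's) transition list" where
  "play_prefix s w 0 = []"
| "play_prefix s w (Suc i) = play_prefix s w i @ [s (play_prefix s w i) (w i)]"

text \<open>
  The first conjunct says that Eve's moves are legal; as a strategy is a total function,
  it has to be required explicitly.
\<close>

definition winning_strategy ::
    "value_function \<Rightarrow> ('a, 's) automaton \<Rightarrow> ('a, 's) strategy \<Rightarrow> bool" where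
  "winning_strategy Val A s \<longleftrightarrow>
     (\<forall>w. (\<forall>i. w i \<in> alphabet A) \<longrightarrow>
        (\<forall>i. is_run A (map w [0..<Suc i]) (play_prefix s w (Suc i)) \<and>
             run_value Val (play_prefix s w (Suc i)) \<ge> word_value Val A (map w [0..<Suc i])))"

definition history_deterministic :: "value_function \<Rightarrow> ('a, 's) automaton \<Rightarrow> bool" where
  "history_deterministic Val A \<longleftrightarrow> (\<exists>s. winning_strategy Val A s)"


section \<open>Word RAMs\<close>

text \<open>
  Random access machines with unit cost per instruction, directly addressed registers and
  an indirectly addressed main memory. Subtraction is truncated. \<open>JZero r l\<close> jumps to
  instruction number \<open>l\<close> if register \<open>r\<close> is zero. The machine has halted once the program
  counter is outside the program.
\<close>

type_synonym reg = nat

datatype instr =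
    LoadConst reg nat
  | Add reg reg reg
  | Sub reg reg reg
  | Mul reg reg reg
  | Load reg reg
  | Store reg reg
  | Jump nat
  | JZero reg nat

type_synonym program = "instr list"

record config =
  pc :: nat
  regs :: "reg \<Rightarrow> nat"
  mem :: "nat \<Rightarrow> nat"

definition set_reg :: "reg \<Rightarrow> nat \<Rightarrow> config \<Rightarrow> config" where
  "set_reg r v c = c\<lparr>pc := Suc (pc c), regs := (regs c)(r := v)\<rparr>"

fun exec_instr :: "instr \<Rightarrow> config \<Rightarrow> config" where
  "exec_instr (LoadConst r k) c = set_reg r k c"
| "exec_instr (Add r i j) c = set_reg r (regs c i + regs c j) c"
| "exec_instr (Sub r i j) c = set_reg r (regs c i - regs c j) c"
| "exec_instr (Mul r i j) c = set_reg r (regs c i * regs c j) c"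
| "exec_instr (Load r i) c = set_reg r (mem c (regs c i)) c"
| "exec_instr (Store i j) c =
     c\<lparr>pc := Suc (pc c), mem := (mem c)(regs c i := regs c j)\<rparr>"
| "exec_instr (Jump l) c = c\<lparr>pc := l\<rparr>"
| "exec_instr (JZero r l) c = c\<lparr>pc := (if regs c r = 0 then l else Suc (pc c))\<rparr>"

definition halted :: "program \<Rightarrow> config \<Rightarrow> bool" where
  "halted P c \<longleftrightarrow> pc c \<ge> length P"

definition step :: "program \<Rightarrow> config \<Rightarrow> config" where
  "step P c = (if halted P c then c else exec_instr (P ! pc c) c)"

definition initial_config :: "nat list \<Rightarrow> config" where
  "initial_config xs =
     \<lparr>pc = 0, regs = (\<lambda>_. 0), mem = (\<lambda>i. if i < length xs then xs ! i else 0)\<rparr>"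

definition config_after :: "program \<Rightarrow> nat list \<Rightarrow> nat \<Rightarrow> config" where
  "config_after P xs t = (step P ^^ t) (initial_config xs)"

text \<open>
  A single program decides \<open>Yes\<close> on all instances satisfying the promise \<open>Inst\<close>, on every
  encoding of the instance, within \<open>O(f n)\<close> steps for instances of size \<open>n\<close>; the answer is
  left in register 0. All numbers occurring in the computation are polynomially bounded
  in \<open>n\<close>, that is, they fit in machine words of \<open>O(log n)\<close> bits. This is what makes unit
  cost arithmetic realistic.
\<close>

definition decidable_in_time ::
    "('i \<Rightarrow> bool) \<Rightarrow> ('i \<Rightarrow> nat list \<Rightarrow> bool) \<Rightarrow> ('i \<Rightarrow> nat) \<Rightarrow> ('i \<Rightarrow> bool) \<Rightarrow> (nat \<Rightarrow> nat) \<Rightarrow> bool"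
  where
  "decidable_in_time Inst enc size_of Yes f \<longleftrightarrow>
     (\<exists>P c d. \<forall>A xs. Inst A \<longrightarrow> enc A xs \<longrightarrow>
        (\<exists>t \<le> c * f (size_of A).
           halted P (config_after P xs t) \<and>
           regs (config_after P xs t) 0 = (if Yes A then 1 else 0)) \<and>
        (\<forall>t r. regs (config_after P xs t) r \<le> c * size_of A ^ d \<and>
               mem (config_after P xs t) r \<le> c * size_of A ^ d))"


section \<open>Encoding automata as inputs\<close>

text \<open>
  States and letters are numbered from 0 in an arbitrary way, and the transitions are
  listed in an arbitrary order. The encoding of weights is meant for automata with
  weights in \<open>{0, 1}\<close>.
\<close>

definition encode_transition ::
    "('s \<Rightarrow> nat) \<Rightarrow> ('a \<Rightarrow> nat) \<Rightarrow> ('a, 's) transition \<Rightarrow> nat list" where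
  "encode_transition f g t =
     [f (source t), g (letter t), (if weight t = 1 then 1 else 0), f (target t)]"

definition encodes :: "('a, 's) automaton \<Rightarrow> nat list \<Rightarrow> bool" where
  "encodes A xs \<longleftrightarrow>
     (\<exists>f g ts.
        bij_betw f (states A) {..<card (states A)} \<and>
        bij_betw g (alphabet A) {..<card (alphabet A)} \<and>
        distinct ts \<and> set ts = transitions A \<and>
        xs = [card (alphabet A), card (states A), f (init A), length ts]
               @ concat (map (encode_transition f g) ts))"

lemma finite_transitions:
  assumes "automaton A"
  shows "finite (transitions A)"
proof -
  have "transitions A =
      (\<Union>q\<in>states A. \<Union>a\<in>alphabet A. (\<lambda>(x, q'). Transition q a x q') ` delta A q a)"
    by (fastforce simp: transitions_def)
  then show ?thesis
    using assms by (auto simp: automaton_def)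
qed

lemma encoding_exists:
  assumes "automaton A"
  shows "\<exists>xs. encodes A xs"
proof -
  obtain f where "bij_betw f (states A) {..<card (states A)}"
    using assms ex_bij_betw_finite_nat[of "states A"] by (auto simp: automaton_def atLeast0LessThan)
  moreover obtain g where "bij_betw g (alphabet A) {..<card (alphabet A)}"
    using assms ex_bij_betw_finite_nat[of "alphabet A"] by (auto simp: automaton_def atLeast0LessThan)
  moreover obtain ts where "set ts = transitions A" "distinct ts"
    using finite_distinct_list[OF finite_transitions[OF assms]] by blast
  ultimately show ?thesis
    unfolding encodes_def by blast
qed

end

theory Submission
  imports Defs
begin

text \<open>
  In a reachability or safety automaton the value of a nonempty run is the weight of its last
  transition, so both cases are the same problem. Such an automaton is history-deterministic iff Eve
  wins the one-token game, in which Adam answers each of her transitions with a transition of his own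
  token over the same letter: a winning region \<open>R\<close> is a relation such that, for all \<open>(q, p) \<in> R\<close> and
  every letter, Eve has a transition from \<open>q\<close> that is at least as good as every transition from \<open>p\<close>,
  with related targets. A strategy that stays in \<open>R\<close> against all transitions from Eve's own state wins
  the letter game, since every run over the same word is linked to Eve's run by a chain of \<open>R\<close>-steps.

  The complement of the largest such \<open>R\<close> is a least fixpoint of an alternating reachability problem,
  computed with a queue. With \<open>m\<close> transitions, the queue receives \<open>O(m\<^sup>2)\<close> pairs of a transition of Eve
  and a state of Adam. Handling one pair takes \<open>O(m)\<close> steps, plus \<open>O(m)\<close> each time one
  of at most \<open>m\<^sup>2\<close> pairs of a transition of Eve and a state of Adam is found to be good for Adam, which
  gives cubic time.
\<close>

section \<open>History-determinism and the one-token game\<close>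

text \<open>The fixpoint is never defined as such. It is pinned down from two sides: throughout the
  run every position found to be won by Adam is avoided by every relation satisfying
  \<open>simulates\<close>, and once the queue is exhausted the complement of the positions found
  satisfies \<open>simulates\<close> itself.

  The claim concerns a concrete machine and limits the numbers in every configuration as well as the
  number of steps. The program logic therefore carries a clock in its assertions and a global bound
  \<open>M\<close> on all cells. Since the queue grows while it is being processed, the time spent
  on \<open>Ref\<close> cannot be assigned to single rounds of the main loop; it is amortised, with
  \<open>card Ref\<close> as potential in the time bounds.

  The machine offers only truncated subtraction and a test for zero. Conditions are thus computed as
  numbers for which zero means true: the sum of both truncated differences expresses equality,
  addition expresses conjunction and multiplication disjunction.\<close>

definition end_state :: "('a, 's) automaton \<Rightarrow> ('a, 's) transition list \<Rightarrow> 's" where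
  "end_state A \<rho> = (if \<rho> = [] then init A else target (last \<rho>))"

lemma end_state_simps [simp]:
  "end_state A [] = init A" "end_state A (\<rho> @ [t]) = target t"
  by (simp_all add: end_state_def)

section \<open>Runs and their values\<close>

lemma is_run_Nil [simp]: "is_run A [] \<rho> \<longleftrightarrow> \<rho> = []"
  by (auto simp: is_run_def)

lemma is_run_snoc:
  "is_run A (w @ [a]) (\<rho> @ [t]) \<longleftrightarrow>
     is_run A w \<rho> \<and> t \<in> transitions A \<and> letter t = a \<and> source t = end_state A \<rho>"
proof (cases "length \<rho> = length w")
  case True
  have last: "end_state A \<rho> = (if length w = 0 then init A else target (\<rho> ! (length w - 1)))"
    using True by (auto simp: end_state_def last_conv_nth)
  have "(\<rho> @ [t]) ! i = \<rho> ! i \<and> (\<rho> @ [t]) ! (i - 1) = \<rho> ! (i - 1) \<and> (w @ [a]) ! i = w ! i"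
    if "i < length w" for i
    using that True by (simp add: nth_append less_imp_diff_less)
  then have eq: "is_run A w \<rho> \<longleftrightarrow> (\<forall>i<length w. (\<rho> @ [t]) ! i \<in> transitions A \<and>
      letter ((\<rho> @ [t]) ! i) = (w @ [a]) ! i \<and>
      source ((\<rho> @ [t]) ! i) = (if i = 0 then init A else target ((\<rho> @ [t]) ! (i - 1))))"
    unfolding is_run_def using True by auto
  have "(\<rho> @ [t]) ! length w = t" "(w @ [a]) ! length w = a"
    "length w \<noteq> 0 \<Longrightarrow> (\<rho> @ [t]) ! (length w - 1) = \<rho> ! (length w - 1)"
    using True by (simp_all add: nth_append)
  then show ?thesis
    unfolding eq last using True by (simp only: is_run_def All_less_Suc length_append length_Cons list.size add_0_right
      add_Suc_right) auto
next
  case False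
  then show ?thesis by (auto simp: is_run_def)
qed

lemma is_run_snocE:
  assumes "is_run A (w @ [a]) \<rho>"
  obtains \<rho>' t where "\<rho> = \<rho>' @ [t]" "is_run A w \<rho>'" "t \<in> transitions A" "letter t = a"
    "source t = end_state A \<rho>'"
proof -
  from assms have "\<rho> \<noteq> []" by (auto simp: is_run_def)
  then have "\<rho> = butlast \<rho> @ [last \<rho>]" by simp
  then show ?thesis using assms is_run_snoc that by metis
qed

lemma transitions_closed:
  assumes "automaton A" "t \<in> transitions A"
  shows "source t \<in> states A" "letter t \<in> alphabet A" "target t \<in> states A"
  using assms by (fastforce simp: automaton_def transitions_def)+

lemma transition_exists:
  assumes "automaton A" "q \<in> states A" "a \<in> alphabet A"
  shows "\<exists>t\<in>transitions A. source t = q \<and> letter t = a"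
proof -
  have "delta A q a \<noteq> {}" using assms by (auto simp: automaton_def)
  then obtain x q' where "(x, q') \<in> delta A q a" by fastforce
  then have "Transition q a x q' \<in> transitions A" using assms by (auto simp: transitions_def)
  then show ?thesis by force
qed

text \<open>A transition of weight \<open>b\<close> enters a sink whose loops have weight
  \<open>b\<close>, so \<open>b\<close> occurs in a nonempty run iff it is the last weight. With
  weights in {0, 1}, this makes the supremum (for \<open>b = 1\<close>) and the infimum (for
  \<open>b = 0\<close>) equal to the last weight.\<close>

lemma is_run_absorbing:
  assumes "absorbing_automaton b A" "is_run A w \<rho>"
  shows "set \<rho> \<subseteq> transitions A \<and>
    (\<forall>t\<in>set \<rho>. weight t = b \<longrightarrow> weight (last \<rho>) = b)"
  using assms(2)
proof (induction w arbitrary: \<rho> rule: rev_induct)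
  case (snoc a w)
  from snoc.prems obtain \<rho>' t where r: "\<rho> = \<rho>' @ [t]" "is_run A w \<rho>'"
    "t \<in> transitions A" "source t = end_state A \<rho>'"
    by (rule is_run_snocE)
  have "weight t = b" if "u \<in> set \<rho>'" "weight u = b" for u
  proof -
    have "\<rho>' \<noteq> []" using that by auto
    moreover have "weight (last \<rho>') = b" "last \<rho>' \<in> transitions A"
      using snoc.IH[OF r(2)] that \<open>\<rho>' \<noteq> []\<close> by (blast, meson last_in_set subsetD)
    moreover have "source t = target (last \<rho>')"
      using r(4) \<open>\<rho>' \<noteq> []\<close> by (simp add: end_state_def)
    ultimately show ?thesis
      using r(3) assms(1) unfolding absorbing_automaton_def by blast
  qed
  then show ?case using r snoc.IH[OF r(2)] by auto
qed simp

lemma run_value_last_sup: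
  assumes "reachability_automaton A" "is_run A w \<rho>" "\<rho> \<noteq> []"
  shows "run_value sup_value \<rho> = real_of_rat (weight (last \<rho>))"
proof -
  let ?S = "real_of_rat ` set (map weight \<rho>)"
  note A = assms(1)[unfolded reachability_automaton_def]
  have sub: "\<forall>t\<in>set \<rho>. weight t \<in> {0, 1}"
    using is_run_absorbing[OF A assms(2)] A by (auto simp: absorbing_automaton_def)
  have "Sup ?S = real_of_rat (weight (last \<rho>))"
  proof (rule cSup_eq_maximum)
    show "real_of_rat (weight (last \<rho>)) \<in> ?S" using assms(3) by simp
    show "x \<le> real_of_rat (weight (last \<rho>))" if "x \<in> ?S" for x
      using that sub is_run_absorbing[OF A assms(2)] last_in_set[OF assms(3)]
      by auto
  qed
  then show ?thesis by (simp add: run_value_def sup_value_def)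
qed

lemma run_value_last_inf:
  assumes "safety_automaton A" "is_run A w \<rho>" "\<rho> \<noteq> []"
  shows "run_value inf_value \<rho> = real_of_rat (weight (last \<rho>))"
proof -
  let ?S = "real_of_rat ` set (map weight \<rho>)"
  note A = assms(1)[unfolded safety_automaton_def]
  have sub: "\<forall>t\<in>set \<rho>. weight t \<in> {0, 1}"
    using is_run_absorbing[OF A assms(2)] A by (auto simp: absorbing_automaton_def)
  have "Inf ?S = real_of_rat (weight (last \<rho>))"
  proof (rule cInf_eq_minimum)
    show "real_of_rat (weight (last \<rho>)) \<in> ?S" using assms(3) by simp
    show "real_of_rat (weight (last \<rho>)) \<le> x" if "x \<in> ?S" for x
      using that sub is_run_absorbing[OF A assms(2)] last_in_set[OF assms(3)]
      by auto
  qed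
  then show ?thesis by (simp add: run_value_def inf_value_def)
qed

section \<open>From the letter game to the one-token game and back\<close>

definition one_token_relation :: "('a, 's) automaton \<Rightarrow> ('s \<times> 's) set \<Rightarrow> bool" where
  "one_token_relation A R \<longleftrightarrow>
     (\<forall>(q, p)\<in>R. \<forall>a\<in>alphabet A.
        \<exists>t\<in>transitions A. source t = q \<and> letter t = a \<and>
          (\<forall>u\<in>transitions A. source u = p \<and> letter u = a \<longrightarrow>
             weight u \<le> weight t \<and> (target t, target u) \<in> R))"

lemma play_prefix_cong:
  "(\<And>i. i < k \<Longrightarrow> w i = w' i) \<Longrightarrow> play_prefix s w k = play_prefix s w' k"
  by (induction k) auto

context
  fixes A :: "('a, 's) automaton" and Val :: value_function
  assumes A: "automaton A"
    and weights: "\<And>t. t \<in> transitions A \<Longrightarrow> weight t \<in> {0, 1}"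
    and Val: "\<And>w \<rho>. is_run A w \<rho> \<Longrightarrow> \<rho> \<noteq> [] \<Longrightarrow>
       run_value Val \<rho> = real_of_rat (weight (last \<rho>))"
begin

lemma run_value_snoc:
  assumes "is_run A (w @ [a]) (\<rho> @ [t])"
  shows "run_value Val (\<rho> @ [t]) = real_of_rat (weight t)"
  using Val[OF assms] by simp

lemma word_value_ge:
  assumes "is_run A (w @ [a]) \<rho>"
  shows "run_value Val \<rho> \<le> word_value Val A (w @ [a])"
  unfolding word_value_def
proof (rule cSUP_upper)
  show "bdd_above (run_value Val ` {\<rho>. is_run A (w @ [a]) \<rho>})"
  proof (rule bdd_aboveI)
    fix x assume "x \<in> run_value Val ` {\<rho>. is_run A (w @ [a]) \<rho>}"
    then obtain \<rho> where r: "is_run A (w @ [a]) \<rho>" "x = run_value Val \<rho>" by auto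
    then obtain \<rho>' t where "\<rho> = \<rho>' @ [t]" "t \<in> transitions A" by (auto elim: is_run_snocE)
    then show "x \<le> 1" using r run_value_snoc weights[of t] by auto
  qed
qed (use assms in simp)

text \<open>A winning strategy does not know which run Adam's token follows, so the state it reaches
  after a word can be paired with the end state of every run over that word. Its next transition has
  to match the word value, hence every extension of such a run.\<close>

lemma history_deterministic_imp_relation:
  assumes s: "winning_strategy Val A s"
  shows "\<exists>R \<subseteq> states A \<times> states A. one_token_relation A R \<and> (init A, init A) \<in> R"
proof -
  define R where "R = {(end_state A (play_prefix s w k), end_state A \<rho>) | w k \<rho>.
    (\<forall>i. w i \<in> alphabet A) \<and> is_run A (map w [0..<k]) \<rho>}"
  have init: "init A \<in> states A" using A by (simp add: automaton_def)
  have end_in: "end_state A \<rho> \<in> states A" if "is_run A v \<rho>" for v \<rho>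
    using that
  proof (induction v rule: rev_induct)
    case (snoc a v)
    then show ?case using transitions_closed[OF A] by (auto elim!: is_run_snocE)
  qed (use init in simp)
  have legal: "is_run A (map w [0..<k]) (play_prefix s w k)" if "\<forall>i. w i \<in> alphabet A" for w k
    using s that by (cases k) (auto simp: winning_strategy_def simp del: play_prefix.simps(2))
  have "R \<subseteq> states A \<times> states A"
    using legal end_in by (fastforce simp: R_def)
  moreover have "(init A, init A) \<in> R"
  proof -
    obtain a where "a \<in> alphabet A" using A by (auto simp: automaton_def)
    then show ?thesis unfolding R_def
      by (intro CollectI exI[of _ "\<lambda>_. a"] exI[of _ 0] exI[of _ "[]"]) simp
  qed
  moreover have "one_token_relation A R"
    unfolding one_token_relation_def
  proof safe
    fix q p a assume "(q, p) \<in> R" and a: "a \<in> alphabet A"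
    then obtain w k \<rho> where w: "\<forall>i. w i \<in> alphabet A" and q: "q = end_state A (play_prefix s w k)"
      and run: "is_run A (map w [0..<k]) \<rho>" and p: "p = end_state A \<rho>"
      unfolding R_def by auto
    \<comment> \<open>Adam may play any letter \<open>a\<close> in round \<open>k\<close>: Eve's
      first \<open>k\<close> moves depend only on the earlier letters and stay the same.\<close>
    define w' where "w' = w(k := a)"
    have w': "\<forall>i. w' i \<in> alphabet A" using w a by (simp add: w'_def)
    have pre: "map w' [0..<k] = map w [0..<k]" by (simp add: w'_def)
    have pp: "play_prefix s w' k = play_prefix s w k"
      by (rule play_prefix_cong) (simp add: w'_def)
    have word: "map w' [0..<Suc k] = map w [0..<k] @ [a]" using pre by (simp add: w'_def)
    define t where "t = s (play_prefix s w k) a"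
    have play: "play_prefix s w' (Suc k) = play_prefix s w k @ [t]"
      using pp by (simp add: w'_def t_def)
    have win: "is_run A (map w [0..<k] @ [a]) (play_prefix s w k @ [t])"
      "run_value Val (play_prefix s w k @ [t]) \<ge> word_value Val A (map w [0..<k] @ [a])"
      using s w' word play unfolding winning_strategy_def by metis+
    show "\<exists>t\<in>transitions A. source t = q \<and> letter t = a \<and>
        (\<forall>u\<in>transitions A. source u = p \<and> letter u = a \<longrightarrow>
           weight u \<le> weight t \<and> (target t, target u) \<in> R)"
    proof (intro bexI[of _ t] conjI ballI impI)
      show "source t = q" "letter t = a" "t \<in> transitions A"
        using win(1) q by (simp_all add: is_run_snoc)
      fix u assume u: "u \<in> transitions A" "source u = p \<and> letter u = a"
      then have run': "is_run A (map w [0..<k] @ [a]) (\<rho> @ [u])"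
        using run p by (simp add: is_run_snoc)
      have "real_of_rat (weight u) \<le> real_of_rat (weight t)"
        using word_value_ge[OF run'] win run_value_snoc[OF run'] run_value_snoc[OF win(1)] by simp
      then show "weight u \<le> weight t" by (simp add: of_rat_less_eq)
      show "(target t, target u) \<in> R"
        unfolding R_def
        by (intro CollectI exI[of _ w'] exI[of _ "Suc k"] exI[of _ "\<rho> @ [u]"])
          (use play w' word run' in \<open>simp del: play_prefix.simps(2) upt_Suc\<close>)
    qed
  qed
  ultimately show ?thesis by blast
qed

lemma relation_imp_history_deterministic:
  assumes R: "one_token_relation A R" and init: "(init A, init A) \<in> R"
  shows "history_deterministic Val A"
proof -
  \<comment> \<open>The strategy looks only at Eve's own state and the letter. It needs no more than
    the diagonal pair of her state to be in \<open>R\<close>.\<close>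
  define good where "good q a t \<longleftrightarrow> t \<in> transitions A \<and> source t = q \<and> letter t = a \<and>
    (\<forall>u\<in>transitions A. source u = q \<and> letter u = a \<longrightarrow>
       weight u \<le> weight t \<and> (target t, target u) \<in> R)" for q a t
  define s where "s \<rho> a = (SOME t. good (end_state A \<rho>) a t)" for \<rho> a
  have good_s: "good (end_state A \<rho>) a (s \<rho> a)"
    if "(end_state A \<rho>, end_state A \<rho>) \<in> R" "a \<in> alphabet A" for \<rho> a
  proof -
    have "\<exists>t. good (end_state A \<rho>) a t"
      using R[unfolded one_token_relation_def, rule_format, OF that(1)] that(2)
      unfolding good_def by auto
    then show ?thesis unfolding s_def by (rule someI_ex)
  qed
  text \<open>The relation itself is not transitive, and Eve's state is related only to the states that
    are reachable in one step from her previous state. Chains of related states are needed to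
    reach the states of arbitrary runs.\<close>
  have chain: "\<exists>t\<in>transitions A. source t = q \<and> letter t = letter u \<and> weight u \<le> weight t \<and>
      (target t, target u) \<in> R\<^sup>*"
    if "(q, p) \<in> R\<^sup>*" "u \<in> transitions A" "source u = p" for q p u
    using that
  proof (induction arbitrary: u rule: rtrancl_induct)
    case base
    then show ?case by blast
  next
    case (step y z)
    have "letter u \<in> alphabet A" using transitions_closed[OF A] step.prems by blast
    then obtain t where t: "t \<in> transitions A" "source t = y" "letter t = letter u"
      "weight u \<le> weight t" "(target t, target u) \<in> R"
      using R[unfolded one_token_relation_def, rule_format, OF step.hyps(2)] step.prems by auto
    from step.IH[OF t(1,2)] obtain v where "v \<in> transitions A" "source v = q"
      "letter v = letter u" "weight t \<le> weight v" "(target v, target t) \<in> R\<^sup>*"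
      unfolding t(3) by blast
    then show ?case
      using t(3,4) rtrancl.rtrancl_into_rtrancl[OF _ t(5)] by (intro bexI[of _ v]) auto
  qed
  have play: "is_run A (map w [0..<k]) (play_prefix s w k) \<and>
      (end_state A (play_prefix s w k), end_state A (play_prefix s w k)) \<in> R \<and>
      (\<forall>\<rho>. is_run A (map w [0..<k]) \<rho> \<longrightarrow>
         (end_state A (play_prefix s w k), end_state A \<rho>) \<in> R\<^sup>* \<and>
         (k > 0 \<longrightarrow> weight (last \<rho>) \<le> weight (last (play_prefix s w k))))"
    if w: "\<forall>i. w i \<in> alphabet A" for w k
  proof (induction k)
    case 0
    then show ?case using init by simp
  next
    case (Suc k)
    let ?\<rho> = "play_prefix s w k"
    define q where "q = end_state A ?\<rho>"
    define t where "t = s ?\<rho> (w k)"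
    have word: "map w [0..<Suc k] = map w [0..<k] @ [w k]" by simp
    have g: "good q (w k) t"
      unfolding q_def t_def by (rule good_s) (use Suc.IH w in simp_all)
    have pp: "play_prefix s w (Suc k) = ?\<rho> @ [t]" by (simp add: t_def)
    have "is_run A (map w [0..<k] @ [w k]) (?\<rho> @ [t])"
      using Suc.IH g by (simp add: is_run_snoc good_def q_def)
    \<comment> \<open>Taking \<open>t\<close> itself as the competing transition restores the
      diagonal pair for the next round.\<close>
    moreover have "(target t, target t) \<in> R" using g by (auto simp: good_def)
    moreover have "(target t, end_state A \<rho>) \<in> R\<^sup>* \<and> weight (last \<rho>) \<le> weight t"
      if "is_run A (map w [0..<k] @ [w k]) \<rho>" for \<rho>
    proof -
      from that obtain \<rho>' u where u: "\<rho> = \<rho>' @ [u]" "is_run A (map w [0..<k]) \<rho>'"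
        "u \<in> transitions A" "letter u = w k" "source u = end_state A \<rho>'"
        by (rule is_run_snocE)
      have "(q, end_state A \<rho>') \<in> R\<^sup>*" using Suc.IH u(2) by (simp add: q_def)
      \<comment> \<open>The last transition \<open>u\<close> of the competing run is pulled back
        along the chain to a transition \<open>v\<close> that leaves Eve's own state; there
        \<open>good\<close> compares it with her move \<open>t\<close>.\<close>
      from chain[OF this u(3,5)] obtain v where v: "v \<in> transitions A" "source v = q"
        "letter v = w k" "weight u \<le> weight v" "(target v, target u) \<in> R\<^sup>*"
        using u by auto
      then have "weight v \<le> weight t" "(target t, target v) \<in> R"
        using g by (auto simp: good_def)
      then show ?thesis
        using v(4,5) u(1) converse_rtrancl_into_rtrancl[of "target t" "target v" R "target u"] by simp
    qed
    ultimately show ?case unfolding word pp by (simp only: end_state_simps last_snoc) simp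
  qed
  have "winning_strategy Val A s"
    unfolding winning_strategy_def
  proof (intro allI impI conjI)
    fix w :: "nat \<Rightarrow> 'a" and i assume w: "\<forall>i. w i \<in> alphabet A"
    let ?\<rho> = "play_prefix s w (Suc i)" and ?v = "map w [0..<Suc i]"
    show run: "is_run A ?v ?\<rho>" using play[OF w] by (simp del: upt_Suc play_prefix.simps(2))
    have val: "run_value Val \<rho> = real_of_rat (weight (last \<rho>))" if "is_run A ?v \<rho>" for \<rho>
      using that by (intro Val[OF that]) (auto simp: is_run_def)
    show "word_value Val A ?v \<le> run_value Val ?\<rho>"
      unfolding word_value_def
    proof (rule cSUP_least)
      show "{\<rho>. is_run A ?v \<rho>} \<noteq> {}" using run by blast
      fix \<rho> assume "\<rho> \<in> {\<rho>. is_run A ?v \<rho>}"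
      then have r: "is_run A ?v \<rho>" by simp
      then have "weight (last \<rho>) \<le> weight (last ?\<rho>)" using play[OF w, of "Suc i"] by (simp del: upt_Suc play_prefix.simps(2))
      then show "run_value Val \<rho> \<le> run_value Val ?\<rho>"
        using val[OF r] val[OF run] by (simp add: of_rat_less_eq)
    qed
  qed
  then show ?thesis by (auto simp: history_deterministic_def)
qed

lemma history_deterministic_iff:
  "history_deterministic Val A \<longleftrightarrow>
     (\<exists>R \<subseteq> states A \<times> states A. one_token_relation A R \<and> (init A, init A) \<in> R)"
  using history_deterministic_imp_relation relation_imp_history_deterministic
  by (auto simp: history_deterministic_def)

end

section \<open>Structured programs for word RAMs\<close>

datatype com = Block "instr list" | Seq com com (infixr ";;" 60) | When reg com | While reg com

text \<open>Jump targets are absolute, so compilation depends on the position \<open>b\<close> of the code.\<close>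

primrec csize :: "com \<Rightarrow> nat" where
  "csize (Block is) = length is"
| "csize (c1 ;; c2) = csize c1 + csize c2"
| "csize (When r c) = Suc (csize c)"
| "csize (While r c) = Suc (Suc (csize c))"

primrec compile :: "nat \<Rightarrow> com \<Rightarrow> program" where
  "compile b (Block is) = is"
| "compile b (c1 ;; c2) = compile b c1 @ compile (b + csize c1) c2"
| "compile b (When r c) = JZero r (Suc b + csize c) # compile (Suc b) c"
| "compile b (While r c) = JZero r (Suc (Suc b) + csize c) # compile (Suc b) c @ [Jump b]"

lemma length_compile [simp]: "length (compile b c) = csize c"
  by (induction c arbitrary: b) auto

type_synonym assertion = "nat \<Rightarrow> (reg \<Rightarrow> nat) \<Rightarrow> (nat \<Rightarrow> nat) \<Rightarrow> bool"

text \<open>The first argument of an assertion is a clock: the number of steps executed so far. All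
  registers and memory cells stay bounded by \<open>M\<close> in every intermediate configuration.\<close>

definition bounded_by :: "nat \<Rightarrow> config \<Rightarrow> bool" where
  "bounded_by M s \<longleftrightarrow> (\<forall>i. regs s i \<le> M \<and> mem s i \<le> M)"

text \<open>The surrounding code \<open>pre\<close> and \<open>post\<close> is universally
  quantified, which lets triples about fragments be composed although compiled jump targets are
  absolute. Control always leaves a fragment at its end.\<close>

definition hoare :: "nat \<Rightarrow> assertion \<Rightarrow> com \<Rightarrow> assertion \<Rightarrow> bool" where
  "hoare M P c Q \<longleftrightarrow>
     (\<forall>pre post s k. pc s = length pre \<longrightarrow> bounded_by M s \<longrightarrow> P k (regs s) (mem s) \<longrightarrow>
        (let prog = pre @ compile (length pre) c @ post in
           \<exists>n. pc ((step prog ^^ n) s) = length pre + csize c \<and>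
               Q (k + n) (regs ((step prog ^^ n) s)) (mem ((step prog ^^ n) s)) \<and>
               (\<forall>j\<le>n. bounded_by M ((step prog ^^ j) s))))"

lemma hoareI:
  assumes "\<And>pre post s k prog. prog = pre @ compile (length pre) c @ post \<Longrightarrow>
      pc s = length pre \<Longrightarrow> bounded_by M s \<Longrightarrow> P k (regs s) (mem s) \<Longrightarrow>
      \<exists>n. pc ((step prog ^^ n) s) = length pre + csize c \<and>
          Q (k + n) (regs ((step prog ^^ n) s)) (mem ((step prog ^^ n) s)) \<and>
          (\<forall>j\<le>n. bounded_by M ((step prog ^^ j) s))"
  shows "hoare M P c Q"
  unfolding hoare_def Let_def using assms by blast

lemma hoareE:
  assumes "hoare M P c Q" "prog = pre @ compile (length pre) c @ post"
    "pc s = length pre" "bounded_by M s" "P k (regs s) (mem s)"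
  obtains n where "pc ((step prog ^^ n) s) = length pre + csize c"
    "Q (k + n) (regs ((step prog ^^ n) s)) (mem ((step prog ^^ n) s))"
    "\<And>j. j \<le> n \<Longrightarrow> bounded_by M ((step prog ^^ j) s)"
  using assms unfolding hoare_def Let_def by blast

lemma funpow_bounded_compose:
  assumes "\<And>j. j \<le> n \<Longrightarrow> bounded_by M ((f ^^ j) s)"
    "\<And>j. j \<le> n' \<Longrightarrow> bounded_by M ((f ^^ j) ((f ^^ n) s))" "j \<le> n + n'"
  shows "bounded_by M ((f ^^ j) s)"
proof (cases "j \<le> n")
  case False
  then have "j = (j - n) + n" by simp
  then have "(f ^^ j) s = (f ^^ (j - n)) ((f ^^ n) s)" by (metis comp_apply funpow_add)
  then show ?thesis using assms(2)[of "j - n"] assms(3) by simp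
qed (use assms(1) in simp)

lemma funpow_compose: "(f ^^ n') ((f ^^ n) s) = (f ^^ (n + n')) s"
  by (simp add: add.commute[of n] funpow_add)

lemma hoare_conseq:
  assumes "hoare M P c Q" "\<And>k r m. P' k r m \<Longrightarrow> P k r m" "\<And>k r m. Q k r m \<Longrightarrow> Q' k r m"
  shows "hoare M P' c Q'"
  using assms unfolding hoare_def Let_def by meson

text \<open>Opens existentials in a precondition: values that exist only logically can be fixed for
  the given start configuration before a triple mentioning them is applied.\<close>

lemma hoare_local:
  assumes "\<And>k r m. P k r m \<Longrightarrow> \<exists>P'. P' k r m \<and> hoare M P' c Q"
  shows "hoare M P c Q"
proof (rule hoareI)
  fix pre post s k prog
  assume prog: "prog = pre @ compile (length pre) c @ post"
    and s: "pc s = length pre" "bounded_by M s" "P k (regs s) (mem s)"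
  from assms[OF s(3)] obtain P' where "P' k (regs s) (mem s)" "hoare M P' c Q" by blast
  from hoareE[OF this(2) prog s(1,2) this(1)]
  show "\<exists>n. pc ((step prog ^^ n) s) = length pre + csize c \<and>
      Q (k + n) (regs ((step prog ^^ n) s)) (mem ((step prog ^^ n) s)) \<and>
      (\<forall>j\<le>n. bounded_by M ((step prog ^^ j) s))" by metis
qed

lemma hoare_pre: "hoare M P c Q \<Longrightarrow> (\<And>k r m. P' k r m \<Longrightarrow> P k r m) \<Longrightarrow> hoare M P' c Q"
  by (rule hoare_conseq)

lemma hoare_post: "hoare M P c Q \<Longrightarrow> (\<And>k r m. Q k r m \<Longrightarrow> Q' k r m) \<Longrightarrow> hoare M P c Q'"
  by (rule hoare_conseq)

lemma hoare_seq:
  assumes "hoare M P c1 Q" "hoare M Q c2 R"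
  shows "hoare M P (c1 ;; c2) R"
proof (rule hoareI)
  fix pre post s k prog
  assume prog: "prog = pre @ compile (length pre) (c1 ;; c2) @ post"
    and s: "pc s = length pre" "bounded_by M s" "P k (regs s) (mem s)"
  have p1: "prog = pre @ compile (length pre) c1 @ (compile (length pre + csize c1) c2 @ post)"
    using prog by simp
  from hoareE[OF assms(1) p1 s] obtain n where n:
    "pc ((step prog ^^ n) s) = length pre + csize c1"
    "Q (k + n) (regs ((step prog ^^ n) s)) (mem ((step prog ^^ n) s))"
    "\<And>j. j \<le> n \<Longrightarrow> bounded_by M ((step prog ^^ j) s)" by metis
  let ?pre = "pre @ compile (length pre) c1"
  have p2: "prog = ?pre @ compile (length ?pre) c2 @ post" using prog by simp
  have pc: "pc ((step prog ^^ n) s) = length ?pre" using n(1) by simp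
  from hoareE[OF assms(2) p2 pc n(3)[OF order_refl] n(2)] obtain n' where n':
    "pc ((step prog ^^ n') ((step prog ^^ n) s)) = length ?pre + csize c2"
    "R (k + n + n') (regs ((step prog ^^ n') ((step prog ^^ n) s)))
       (mem ((step prog ^^ n') ((step prog ^^ n) s)))"
    "\<And>j. j \<le> n' \<Longrightarrow> bounded_by M ((step prog ^^ j) ((step prog ^^ n) s))" by metis
  show "\<exists>n. pc ((step prog ^^ n) s) = length pre + csize (c1 ;; c2) \<and>
      R (k + n) (regs ((step prog ^^ n) s)) (mem ((step prog ^^ n) s)) \<and>
      (\<forall>j\<le>n. bounded_by M ((step prog ^^ j) s))"
    using n'(1,2) funpow_bounded_compose[OF n(3) n'(3)]
    by (intro exI[of _ "n + n'"]) (simp add: funpow_compose add.assoc)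
qed

lemma step_nth:
  "prog = pre @ i # post \<Longrightarrow> pc s = length pre \<Longrightarrow> step prog s = exec_instr i s"
  by (simp add: step_def halted_def)

lemma hoare_when:
  assumes then_branch: "hoare M (\<lambda>k r m. \<exists>k0. k = Suc k0 \<and> P k0 r m \<and> r d \<noteq> 0) c Q"
    and else_branch: "\<And>k r m. P k r m \<Longrightarrow> r d = 0 \<Longrightarrow> Q (Suc k) r m"
  shows "hoare M P (When d c) Q"
proof (rule hoareI)
  fix pre post s k prog
  assume prog: "prog = pre @ compile (length pre) (When d c) @ post"
    and s: "pc s = length pre" "bounded_by M s" "P k (regs s) (mem s)"
  have st: "step prog s = s\<lparr>pc := (if regs s d = 0 then Suc (length pre) + csize c else Suc (length pre))\<rparr>"
    using prog s(1) by (subst step_nth[of _ pre]) auto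
  let ?s = "step prog s"
  have b: "bounded_by M ?s" using s(2) st by (simp add: bounded_by_def)
  show "\<exists>n. pc ((step prog ^^ n) s) = length pre + csize (When d c) \<and>
      Q (k + n) (regs ((step prog ^^ n) s)) (mem ((step prog ^^ n) s)) \<and>
      (\<forall>j\<le>n. bounded_by M ((step prog ^^ j) s))"
  proof (cases "regs s d = 0")
    case True
    then show ?thesis
      using st b s else_branch[OF s(3) True] by (intro exI[of _ 1]) (auto simp: le_Suc_eq)
  next
    case False
    let ?pre = "pre @ [JZero d (Suc (length pre) + csize c)]"
    have p: "prog = ?pre @ compile (length ?pre) c @ post" using prog by simp
    have pc: "pc ?s = length ?pre" using st False by simp
    have "\<exists>k0. Suc k = Suc k0 \<and> P k0 (regs ?s) (mem ?s) \<and> regs ?s d \<noteq> 0"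
      using s(3) st False by simp
    from hoareE[OF then_branch p pc b this] obtain n where n:
      "pc ((step prog ^^ n) ?s) = length ?pre + csize c"
      "Q (Suc k + n) (regs ((step prog ^^ n) ?s)) (mem ((step prog ^^ n) ?s))"
      "\<And>j. j \<le> n \<Longrightarrow> bounded_by M ((step prog ^^ j) ?s)" by metis
    have c: "(step prog ^^ j) ?s = (step prog ^^ Suc j) s" for j
      by (simp only: funpow_Suc_right comp_apply)
    have "bounded_by M ((step prog ^^ j) s)" if "j \<le> Suc n" for j
      using that n(3)[unfolded c] s(2) by (cases j) (auto simp del: funpow.simps(2))
    then show ?thesis
      using n(1,2)[unfolded c] by (intro exI[of _ "Suc n"]) (auto simp del: funpow.simps(2))
  qed
qed

text \<open>The invariant \<open>J\<close> refers to the moment right after a test of the loop condition; the two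
  steps between the end of the body and that moment are the jump back and the next test.\<close>

lemma hoare_while:
  fixes f :: "(reg \<Rightarrow> nat) \<Rightarrow> (nat \<Rightarrow> nat) \<Rightarrow> nat"
  assumes body: "\<And>x. hoare M (\<lambda>k r m. J k r m \<and> r d \<noteq> 0 \<and> f r m = x) c
      (\<lambda>k r m. J (k + 2) r m \<and> f r m < x)"
  shows "hoare M (\<lambda>k r m. J (Suc k) r m) (While d c) (\<lambda>k r m. J k r m \<and> r d = 0)"
proof (rule hoareI)
  fix pre post s k prog
  assume prog: "prog = pre @ compile (length pre) (While d c) @ post"
  assume "pc s = length pre" "bounded_by M s" "J (Suc k) (regs s) (mem s)"
  then show "\<exists>n. pc ((step prog ^^ n) s) = length pre + csize (While d c) \<and>
      (J (k + n) (regs ((step prog ^^ n) s)) (mem ((step prog ^^ n) s)) \<and>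
        regs ((step prog ^^ n) s) d = 0) \<and>
      (\<forall>j\<le>n. bounded_by M ((step prog ^^ j) s))"
  proof (induction "f (regs s) (mem s)" arbitrary: s k rule: less_induct)
    case less
    note s = less.prems
    have st: "step prog s = s\<lparr>pc := (if regs s d = 0 then Suc (Suc (length pre)) + csize c else Suc (length pre))\<rparr>"
      using prog s(1) by (subst step_nth[of _ pre]) auto
    let ?s = "step prog s"
    have b: "bounded_by M ?s" using s(2) st by (simp add: bounded_by_def)
    show ?case
    proof (cases "regs s d = 0")
      case True
      then show ?thesis
        using st b s by (intro exI[of _ 1]) (auto simp: le_Suc_eq)
    next
      case False
      let ?pre = "pre @ [JZero d (Suc (Suc (length pre)) + csize c)]"
      have p: "prog = ?pre @ compile (length ?pre) c @ (Jump (length pre) # post)" using prog by simp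
      have pc: "pc ?s = length ?pre" using st False by simp
      have "J (Suc k) (regs ?s) (mem ?s) \<and> regs ?s d \<noteq> 0 \<and>
          f (regs ?s) (mem ?s) = f (regs s) (mem s)"
        using s(3) st False by simp
      from hoareE[OF body p pc b this] obtain n where n:
        "pc ((step prog ^^ n) ?s) = length ?pre + csize c"
        "J (Suc k + n + 2) (regs ((step prog ^^ n) ?s)) (mem ((step prog ^^ n) ?s)) \<and>
          f (regs ((step prog ^^ n) ?s)) (mem ((step prog ^^ n) ?s)) < f (regs s) (mem s)"
        "\<And>j. j \<le> n \<Longrightarrow> bounded_by M ((step prog ^^ j) ?s)" by metis
      let ?t = "(step prog ^^ n) ?s"
      let ?u = "step prog ?t"
      have u: "?u = ?t\<lparr>pc := length pre\<rparr>"
        using p n(1) by (subst step_nth[of _ "?pre @ compile (length ?pre) c" _ post]) auto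
      have bu: "bounded_by M ?u" using n(3)[OF order_refl] u by (simp add: bounded_by_def)
      obtain n' where n':
        "pc ((step prog ^^ n') ?u) = length pre + csize (While d c)"
        "J (k + n + 2 + n') (regs ((step prog ^^ n') ?u)) (mem ((step prog ^^ n') ?u))"
        "regs ((step prog ^^ n') ?u) d = 0"
        "\<And>j. j \<le> n' \<Longrightarrow> bounded_by M ((step prog ^^ j) ?u)"
        using less.hyps[of ?u "k + n + 2"] u bu n(2) by auto
      have c: "(step prog ^^ j) ?s = (step prog ^^ Suc j) s" for j
        by (simp only: funpow_Suc_right comp_apply)
      have u_eq: "?u = (step prog ^^ (n + 2)) s"
        unfolding c by simp
      have bnd: "bounded_by M ((step prog ^^ j) s)" if "j \<le> n + 2" for j
      proof (cases j)
        case (Suc i)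
        show ?thesis
          using n(3)[of i, unfolded c] bu that Suc unfolding u_eq
          by (cases "i \<le> n") (auto simp del: funpow.simps(2) simp: le_Suc_eq)
      qed (use s(2) in simp)
      have e: "(step prog ^^ n') ?u = (step prog ^^ (n + 2 + n')) s"
        unfolding u_eq by (rule funpow_compose)
      show ?thesis
        using n'(1-3)[unfolded e] funpow_bounded_compose[OF bnd n'(4)[unfolded u_eq]]
        by (intro exI[of _ "n + 2 + n'"]) (simp add: add.assoc)
    qed
  qed
qed

text \<open>Weakest preconditions of straight-line code; jumps are excluded. Only constants, sums
  and products can exceed \<open>M\<close>, so only they produce a side condition: subtraction is
  truncated, and loads and stores move values that are already bounded.\<close>

fun wp :: "nat \<Rightarrow> instr list \<Rightarrow> assertion \<Rightarrow> assertion" where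
  "wp M [] Q k r m = Q k r m"
| "wp M (LoadConst d v # is) Q k r m = (v \<le> M \<and> wp M is Q (Suc k) (r(d := v)) m)"
| "wp M (Add d i j # is) Q k r m = (r i + r j \<le> M \<and> wp M is Q (Suc k) (r(d := r i + r j)) m)"
| "wp M (Sub d i j # is) Q k r m = wp M is Q (Suc k) (r(d := r i - r j)) m"
| "wp M (Mul d i j # is) Q k r m = (r i * r j \<le> M \<and> wp M is Q (Suc k) (r(d := r i * r j)) m)"
| "wp M (Load d i # is) Q k r m = wp M is Q (Suc k) (r(d := m (r i))) m"
| "wp M (Store i j # is) Q k r m = wp M is Q (Suc k) r (m(r i := r j))"
| "wp M (Jump l # is) Q k r m = False"
| "wp M (JZero d l # is) Q k r m = False"

lemma wp_Cons:
  assumes "wp M (i # is) Q k (regs s) (mem s)" "bounded_by M s"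
  shows "wp M is Q (Suc k) (regs (exec_instr i s)) (mem (exec_instr i s))"
    and "bounded_by M (exec_instr i s)" and "pc (exec_instr i s) = Suc (pc s)"
  using assms by (cases i; auto simp: set_reg_def bounded_by_def intro: le_trans diff_le_self)+

lemma hoare_block:
  assumes "\<And>k r m. P k r m \<Longrightarrow> wp M is Q k r m"
  shows "hoare M P (Block is) Q"
proof (rule hoareI)
  fix pre post s k prog
  assume prog: "prog = pre @ compile (length pre) (Block is) @ post"
    and s: "pc s = length pre" "bounded_by M s" "P k (regs s) (mem s)"
  have "wp M is Q k (regs s) (mem s)" using assms s(3) .
  then show "\<exists>n. pc ((step prog ^^ n) s) = length pre + csize (Block is) \<and>
      Q (k + n) (regs ((step prog ^^ n) s)) (mem ((step prog ^^ n) s)) \<and>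
      (\<forall>j\<le>n. bounded_by M ((step prog ^^ j) s))"
    using prog s(1,2)
  proof (induction "is" arbitrary: pre s k)
    case Nil
    then show ?case by (intro exI[of _ 0]) simp
  next
    case (Cons i "is")
    have st: "step prog s = exec_instr i s"
      using Cons.prems by (subst step_nth[of _ pre]) auto
    let ?s = "step prog s"
    note w = wp_Cons[OF Cons.prems(1,4), folded st]
    have "prog = (pre @ [i]) @ compile (length (pre @ [i])) (Block is) @ post"
      using Cons.prems by simp
    from Cons.IH[OF w(1) this _ w(2)] Cons.prems(3) w(3) obtain n where n:
      "pc ((step prog ^^ n) ?s) = length (pre @ [i]) + csize (Block is)"
      "Q (Suc k + n) (regs ((step prog ^^ n) ?s)) (mem ((step prog ^^ n) ?s))"
      "\<forall>j\<le>n. bounded_by M ((step prog ^^ j) ?s)" by auto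
    have c: "(step prog ^^ j) ?s = (step prog ^^ Suc j) s" for j
      by (simp only: funpow_Suc_right comp_apply)
    have "bounded_by M ((step prog ^^ j) s)" if "j \<le> Suc n" for j
      using that n(3)[unfolded c] Cons.prems(4) by (cases j) (auto simp del: funpow.simps(2))
    then show ?case
      using n(1,2)[unfolded c] by (intro exI[of _ "Suc n"]) (auto simp del: funpow.simps(2))
  qed
qed

lemma hoare_block_seq:
  assumes "\<And>k r m. P k r m \<Longrightarrow> wp M is Q k r m" "hoare M Q c R"
  shows "hoare M P (Block is ;; c) R"
  using hoare_seq[OF hoare_block assms(2)] assms(1) .

lemma hoare_seq_block:
  assumes "hoare M P c Q" "\<And>k r m. Q k r m \<Longrightarrow> wp M is R k r m"
  shows "hoare M P (c ;; Block is) R"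
  using hoare_seq[OF assms(1) hoare_block] assms(2) .

definition For :: "reg \<Rightarrow> reg \<Rightarrow> reg \<Rightarrow> reg \<Rightarrow> com \<Rightarrow> com" where
  "For i n one d c =
     Block [LoadConst i 0, Sub d n i] ;; While d (c ;; Block [Add i i one, Sub d n i])"

text \<open>The four extra steps per iteration are the two counter updates, the jump back and the test.\<close>

lemma hoare_for:
  assumes M: "N \<le> M" and regs: "i \<noteq> n" "d \<noteq> n" "d \<noteq> i"
    and init: "\<And>k r m. P k r m \<Longrightarrow> r n = N \<and> I 0 (k + 3) (r(i := 0, d := N)) m"
    and body: "\<And>j. j < N \<Longrightarrow> hoare M (\<lambda>k r m. I j k r m \<and> r i = j \<and> r d = N - j) c
      (\<lambda>k r m. r i = j \<and> r one = 1 \<and> r n = N \<and> I (Suc j) (k + 4) (r(i := Suc j, d := N - Suc j)) m)"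
    and final: "\<And>k r m. I N k r m \<Longrightarrow> Q k r m"
  shows "hoare M P (For i n one d c) Q"
proof -
  let ?J = "\<lambda>k r m. \<exists>j\<le>N. I j k r m \<and> r i = j \<and> r d = N - j"
  have loop: "hoare M (\<lambda>k r m. ?J k r m \<and> r d \<noteq> 0 \<and> r d = x) (c ;; Block [Add i i one, Sub d n i])
      (\<lambda>k r m. ?J (k + 2) r m \<and> r d < x)" for x
  proof (cases "0 < x \<and> x \<le> N")
    case True
    \<comment> \<open>The measure determines the iteration: \<open>d\<close> holds
      \<open>N - j\<close>, so its value \<open>x\<close> means that \<open>j\<close> is
      \<open>N - x\<close>. For other values of \<open>x\<close> the precondition is
      unsatisfiable.\<close>
    have "N - x < N" using True by simp
    from body[OF this] show ?thesis
    proof (rule hoare_seq_block[OF hoare_pre])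
      fix k r m assume "?J k r m \<and> r d \<noteq> 0 \<and> r d = x"
      then obtain j where "j \<le> N" "I j k r m" "r i = j" "r d = N - j" "r d = x" by auto
      then show "I (N - x) k r m \<and> r i = N - x \<and> r d = N - (N - x)"
        by auto
    next
      fix k r m
      have k: "Suc (Suc k) + 2 = k + 4" by simp
      assume *: "r i = N - x \<and> r one = 1 \<and> r n = N \<and>
        I (Suc (N - x)) (k + 4) (r(i := Suc (N - x), d := N - Suc (N - x))) m"
      show "wp M [Add i i one, Sub d n i] (\<lambda>k r m. ?J (k + 2) r m \<and> r d < x) k r m"
        using * True regs M \<open>N - x < N\<close>[THEN Suc_leI] unfolding wp.simps k
        by (intro conjI exI[of _ "Suc (N - x)"]) simp_all
    qed
  next
    case False
    then show ?thesis unfolding hoare_def by auto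
  qed
  have while: "hoare M (\<lambda>k r m. ?J (Suc k) r m) (While d (c ;; Block [Add i i one, Sub d n i]))
      (\<lambda>k r m. ?J k r m \<and> r d = 0)"
    by (rule hoare_while[where f = "\<lambda>r m. r d"]) (rule loop)
  show ?thesis
    unfolding For_def
  proof (rule hoare_block_seq[OF _ hoare_conseq[OF while]])
    fix k r m assume "P k r m"
    \<comment> \<open>Two instructions before the loop and its first test.\<close>
    have k: "Suc (Suc (Suc k)) = k + 3" by simp
    show "wp M [LoadConst i 0, Sub d n i] (\<lambda>k r m. ?J (Suc k) r m) k r m"
      using init[OF \<open>P k r m\<close>] regs unfolding wp.simps k
      by (intro conjI exI[of _ 0]) simp_all
  qed (use final in auto)
qed

section \<open>Solving the one-token game\<close>

locale game_instance =
  fixes m nQ nA i0 :: nat and src lt wt tgt :: "nat \<Rightarrow> nat"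
  assumes src: "t < m \<Longrightarrow> src t < nQ" and tgt: "t < m \<Longrightarrow> tgt t < nQ"
    and lt: "t < m \<Longrightarrow> lt t < nA" and wt: "t < m \<Longrightarrow> wt t \<le> 1" and init: "i0 < nQ"
    and total: "q < nQ \<Longrightarrow> a < nA \<Longrightarrow> \<exists>t<m. src t = q \<and> lt t = a"
begin

definition simulates :: "(nat \<times> nat) set \<Rightarrow> bool" where
  "simulates R \<longleftrightarrow> (\<forall>q p a. (q, p) \<in> R \<longrightarrow> a < nA \<longrightarrow>
     (\<exists>t<m. src t = q \<and> lt t = a \<and>
       (\<forall>u<m. src u = p \<and> lt u = a \<longrightarrow> wt u \<le> wt t \<and> (tgt t, tgt u) \<in> R)))"

text \<open>The queue \<open>qs\<close> holds pairs of a transition of Eve and a state of Adam. An entry \<open>(t, p)\<close>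
  with \<open>p < nQ\<close> records that Adam wins from the pair of \<open>tgt t\<close> and \<open>p\<close>; the dummy entries
  \<open>(t, nQ)\<close> make the weights of \<open>t\<close> be compared at least once. \<open>Ref\<close> contains the pairs of a
  transition \<open>t\<close> of Eve and a state \<open>p\<close> of Adam such that Adam has a winning reply to \<open>t\<close> from \<open>p\<close>,
  and \<open>B\<close> the positions known to be won by Adam.\<close>

definition refutes :: "nat \<Rightarrow> nat \<Rightarrow> nat \<Rightarrow> bool" where
  "refutes t p' u \<longleftrightarrow> lt u = lt t \<and> (tgt u = p' \<or> wt t < wt u)"

text \<open>Depends on \<open>t\<close> only through its source and letter. Thus \<open>t\<close>
  stands for Adam's choice of the letter \<open>lt t\<close> in position \<open>(src t, p)\<close>,
  which wins if he can refute every transition available to Eve.\<close>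

definition complete :: "(nat \<times> nat) set \<Rightarrow> nat \<Rightarrow> nat \<Rightarrow> bool" where
  "complete Ref t p \<longleftrightarrow> (\<forall>u<m. src u = src t \<and> lt u = lt t \<longrightarrow> (u, p) \<in> Ref)"

definition edges_to :: "nat \<Rightarrow> nat \<Rightarrow> (nat \<times> nat) list" where
  "edges_to q p = map (\<lambda>u. (u, p)) (filter (\<lambda>u. tgt u = q) [0..<m])"

text \<open>The conjunct on \<open>complete\<close> says that every consequence of
  \<open>Ref\<close> for \<open>B\<close> has been drawn, so that all outstanding work lies in the
  queue. The last conjunct is soundness, expressed against all relations satisfying
  \<open>simulates\<close> instead of a fixpoint.\<close>

definition algorithm_inv :: "(nat \<times> nat) set \<Rightarrow> (nat \<times> nat) set \<Rightarrow> (nat \<times> nat) list \<Rightarrow> bool" where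
  "algorithm_inv Ref B qs \<longleftrightarrow>
     Ref \<subseteq> {..<m} \<times> {..<nQ} \<and> B \<subseteq> {..<nQ} \<times> {..<nQ} \<and>
     distinct qs \<and> set qs = {..<m} \<times> {nQ} \<union> {(u, p). u < m \<and> (tgt u, p) \<in> B} \<and>
     (\<forall>t<m. \<forall>p<nQ. complete Ref t p \<longrightarrow> (src t, p) \<in> B) \<and>
     (\<forall>R. simulates R \<longrightarrow> B \<inter> R = {} \<and>
        (\<forall>(t, p)\<in>Ref. \<exists>u<m. src u = p \<and> lt u = lt t \<and> (wt t < wt u \<or> (tgt t, tgt u) \<notin> R)))"

text \<open>All refutations caused by entries before the head \<open>h\<close> are recorded. When
  the head reaches the end, \<open>Ref\<close> and \<open>B\<close> are closed under both inference
  rules.\<close>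

definition handled :: "(nat \<times> nat) set \<Rightarrow> (nat \<times> nat) list \<Rightarrow> nat \<Rightarrow> bool" where
  "handled Ref qs h \<longleftrightarrow> h \<le> length qs \<and>
     (\<forall>k<h. \<forall>u<m. refutes (fst (qs ! k)) (snd (qs ! k)) u \<longrightarrow> (fst (qs ! k), src u) \<in> Ref)"

lemma invD:
  assumes "algorithm_inv Ref B qs"
  shows "Ref \<subseteq> {..<m} \<times> {..<nQ}" "B \<subseteq> {..<nQ} \<times> {..<nQ}" "distinct qs"
    "(t, p) \<in> set qs \<longleftrightarrow> t < m \<and> (p = nQ \<or> (tgt t, p) \<in> B)"
    "t < m \<Longrightarrow> p < nQ \<Longrightarrow> complete Ref t p \<Longrightarrow> (src t, p) \<in> B"
    "simulates R \<Longrightarrow> B \<inter> R = {}"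
    "simulates R \<Longrightarrow> (t, p) \<in> Ref \<Longrightarrow>
       \<exists>u<m. src u = p \<and> lt u = lt t \<and> (wt t < wt u \<or> (tgt t, tgt u) \<notin> R)"
proof -
  note inv = assms[unfolded algorithm_inv_def]
  show "Ref \<subseteq> {..<m} \<times> {..<nQ}" using inv by (elim conjE)
  show "B \<subseteq> {..<nQ} \<times> {..<nQ}" using inv by (elim conjE)
  show "distinct qs" using inv by (elim conjE)
  have "set qs = {..<m} \<times> {nQ} \<union> {(u, p). u < m \<and> (tgt u, p) \<in> B}"
    using inv by (elim conjE)
  then show "(t, p) \<in> set qs \<longleftrightarrow> t < m \<and> (p = nQ \<or> (tgt t, p) \<in> B)"
    by auto
  have closed: "\<forall>t<m. \<forall>p<nQ. complete Ref t p \<longrightarrow> (src t, p) \<in> B"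
    using inv by (elim conjE)
  show "(src t, p) \<in> B" if "t < m" "p < nQ" "complete Ref t p"
    using closed that by simp
  have all: "\<forall>R. simulates R \<longrightarrow> B \<inter> R = {} \<and>
      (\<forall>(t, p)\<in>Ref. \<exists>u<m. src u = p \<and> lt u = lt t \<and> (wt t < wt u \<or> (tgt t, tgt u) \<notin> R))"
    using inv by (elim conjE)
  assume "simulates R"
  note R = all[rule_format, OF this]
  show "B \<inter> R = {}" using R by (rule conjunct1)
  assume "(t, p) \<in> Ref"
  show "\<exists>u<m. src u = p \<and> lt u = lt t \<and> (wt t < wt u \<or> (tgt t, tgt u) \<notin> R)"
    using bspec[OF conjunct2[OF R] \<open>(t, p) \<in> Ref\<close>] by (simp only: prod.case)
qed

text \<open>As entries are distinct, the bound on their set limits the length of the queue, and with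
  it both the queue's memory and the number of rounds of the main loop. The extra column in
  \<open>nQ + 1\<close> is that of the dummy entries.\<close>

lemma inv_bounds:
  assumes "algorithm_inv Ref B qs"
  shows "finite Ref" "card Ref \<le> m * nQ" "length qs \<le> m * (nQ + 1)"
    "set qs \<subseteq> {..<m} \<times> {..nQ}"
proof -
  note R = invD(1)[OF assms]
  then show "finite Ref" by (rule finite_subset) simp
  show "card Ref \<le> m * nQ" using card_mono[OF _ R] by simp
  show S: "set qs \<subseteq> {..<m} \<times> {..nQ}"
    using invD(4)[OF assms] invD(2)[OF assms] by fastforce
  have "length qs = card (set qs)" using invD(3)[OF assms] by (simp add: distinct_card)
  then show "length qs \<le> m * (nQ + 1)" using card_mono[OF _ S] by simp
qed

lemma inv_init: "algorithm_inv {} {} (map (\<lambda>u. (u, nQ)) [0..<m])"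
  by (auto simp: algorithm_inv_def distinct_map inj_on_def complete_def)

text \<open>Adding \<open>(t, src u)\<close> can complete only choices with the source and letter of
  \<open>t\<close>. Hence \<open>(src t, src u)\<close> is the only position that can become won,
  and a single check suffices.\<close>

lemma inv_refute:
  assumes inv: "algorithm_inv Ref B qs" and t: "t < m" "(t, p') \<in> set qs" and u: "u < m" "refutes t p' u"
    and Ref': "Ref' = insert (t, src u) Ref"
  shows "complete Ref' t (src u) \<Longrightarrow> (src t, src u) \<notin> B \<Longrightarrow>
      algorithm_inv Ref' (insert (src t, src u) B) (qs @ edges_to (src t) (src u))"
    and "\<not> complete Ref' t (src u) \<or> (src t, src u) \<in> B \<Longrightarrow> algorithm_inv Ref' B qs"
proof -
  define p where "p = src u"
  have p: "p < nQ" using src u by (simp add: p_def)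
  have other: "complete Ref' t' p'' \<longleftrightarrow> complete Ref t' p''"
    if "p'' \<noteq> p \<or> src t' \<noteq> src t \<or> lt t' \<noteq> lt t" for t' p''
    using that unfolding complete_def Ref' p_def by auto
  have same: "complete Ref' t' p \<longleftrightarrow> complete Ref' t p"
    if "src t' = src t" "lt t' = lt t" for t'
    using that by (simp add: complete_def)
  have closed: "(src t', p'') \<in> B \<or> (src t' = src t \<and> p'' = p \<and> complete Ref' t p)"
    if "t' < m" "p'' < nQ" "complete Ref' t' p''" for t' p''
    using that invD(5)[OF inv that(1,2)] other[of p'' t'] same[of t'] by metis
  have sound: "\<exists>u<m. src u = p'' \<and> lt u = lt t' \<and> (wt t' < wt u \<or> (tgt t', tgt u) \<notin> R)"
    if "simulates R" "(t', p'') \<in> Ref'" for R t' p''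
  proof (cases "(t', p'') \<in> Ref")
    case True
    then show ?thesis using invD(7)[OF inv that(1)] by blast
  next
    case False
    then have e: "t' = t" "p'' = src u" using that(2) by (auto simp: Ref')
    \<comment> \<open>As the target of a transition, \<open>p'\<close> lies below \<open>nQ\<close>.
      The entry is therefore not a dummy and certifies a position in \<open>B\<close>, which
      \<open>R\<close> avoids.\<close>
    have "(tgt t, tgt u) \<notin> R" if "tgt u = p'"
    proof -
      have "p' < nQ" using that tgt u by auto
      then have "(tgt t, p') \<in> B" using t invD(4)[OF inv] by auto
      then show ?thesis using invD(6)[OF inv \<open>simulates R\<close>] that by blast
    qed
    then show ?thesis using u e by (auto simp: refutes_def intro!: exI[of _ u])
  qed
  have Ref'_sub: "Ref' \<subseteq> {..<m} \<times> {..<nQ}"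
    using invD(1)[OF inv] t u src by (auto simp: Ref')
  {
    assume c: "complete Ref' t (src u)" and new: "(src t, src u) \<notin> B"
    \<comment> \<open>If \<open>R\<close> contained the new position, its answer \<open>v\<close> to
      the letter \<open>lt t\<close> would be in \<open>Ref'\<close> together with \<open>p\<close>,
      and the refuting reply contradicts the choice of \<open>v\<close>.\<close>
    have disj: "insert (src t, p) B \<inter> R = {}" if R: "simulates R" for R
    proof -
      have "(src t, p) \<notin> R"
      proof
        assume "(src t, p) \<in> R"
        then obtain v where v: "v < m" "src v = src t" "lt v = lt t"
          "\<forall>u<m. src u = p \<and> lt u = lt t \<longrightarrow> wt u \<le> wt v \<and> (tgt v, tgt u) \<in> R"
          using R lt[OF t(1)] unfolding simulates_def by metis
        then have "(v, p) \<in> Ref'" using c by (auto simp: complete_def p_def)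
        from sound[OF R this] v show False by force
      qed
      then show ?thesis using invD(6)[OF inv R] by blast
    qed
    have "distinct (qs @ edges_to (src t) (src u))"
      using invD(3,4)[OF inv] new src[OF u(1)]
      by (auto simp: edges_to_def distinct_map inj_on_def)
    moreover have "set (qs @ edges_to (src t) (src u)) =
        {..<m} \<times> {nQ} \<union> {(v, p). v < m \<and> (tgt v, p) \<in> insert (src t, src u) B}"
      using inv by (auto simp: algorithm_inv_def edges_to_def)
    moreover have "insert (src t, src u) B \<subseteq> {..<nQ} \<times> {..<nQ}"
      using invD(2)[OF inv] src t(1) u(1) by auto
    moreover have "\<forall>t'<m. \<forall>p'<nQ. complete Ref' t' p' \<longrightarrow>
        (src t', p') \<in> insert (src t, src u) B"
      using closed by (auto simp: p_def)
    ultimately show "algorithm_inv Ref' (insert (src t, src u) B) (qs @ edges_to (src t) (src u))"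
      unfolding algorithm_inv_def using Ref'_sub disj sound by (auto simp: p_def)
  }
  {
    assume "\<not> complete Ref' t (src u) \<or> (src t, src u) \<in> B"
    then have "\<forall>t<m. \<forall>p<nQ. complete Ref' t p \<longrightarrow> (src t, p) \<in> B"
      using closed by (metis p_def)
    moreover have "B \<inter> R = {}" if "simulates R" for R
      using that invD(6)[OF inv] by simp
    moreover have "distinct qs"
      "set qs = {..<m} \<times> {nQ} \<union> {(u, p). u < m \<and> (tgt u, p) \<in> B}"
      using inv by (simp_all add: algorithm_inv_def)
    ultimately show "algorithm_inv Ref' B qs"
      unfolding algorithm_inv_def using Ref'_sub sound invD(2)[OF inv] by auto
  }
qed

lemma handled_append:
  assumes "handled Ref qs h" "Ref \<subseteq> Ref'"
  shows "handled Ref' (qs @ zs) h"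
  unfolding handled_def
proof (intro conjI allI impI)
  show "h \<le> length (qs @ zs)" using assms(1) by (simp add: handled_def)
  fix k u assume *: "k < h" "u < m" "refutes (fst ((qs @ zs) ! k)) (snd ((qs @ zs) ! k)) u"
  then have "(qs @ zs) ! k = qs ! k" using assms(1) by (simp add: handled_def nth_append)
  then show "(fst ((qs @ zs) ! k), src u) \<in> Ref'"
    using * assms by (auto simp: handled_def)
qed

lemma handled_Suc:
  assumes "handled Ref qs h" "h < length qs" "qs ! h = (t, p')"
    "\<And>u. u < m \<Longrightarrow> refutes t p' u \<Longrightarrow> (t, src u) \<in> Ref"
  shows "handled Ref qs (Suc h)"
  using assms by (auto simp: handled_def less_Suc_eq)

text \<open>The complement of \<open>B\<close> satisfies \<open>simulates\<close>: outside
  \<open>B\<close> every choice of a letter leaves Eve a transition not recorded in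
  \<open>Ref\<close>, and no processed entry refutes it. The converse is the soundness part of the
  invariant.\<close>

lemma result_correct:
  assumes inv: "algorithm_inv Ref B qs" and h: "handled Ref qs (length qs)"
  shows "(i0, i0) \<notin> B \<longleftrightarrow> (\<exists>R \<subseteq> {..<nQ} \<times> {..<nQ}. simulates R \<and> (i0, i0) \<in> R)"
proof
  assume i0: "(i0, i0) \<notin> B"
  define R where "R = {..<nQ} \<times> {..<nQ} - B"
  have handled: "(t, src u) \<in> Ref" if "(t, p) \<in> set qs" "u < m" "refutes t p u" for t p u
  proof -
    obtain k where "k < length qs" "qs ! k = (t, p)" using \<open>(t, p) \<in> set qs\<close> by (auto simp: in_set_conv_nth)
    then show ?thesis using h that(2,3) unfolding handled_def by fastforce
  qed
  have "simulates R"
    unfolding simulates_def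
  proof (intro allI impI)
    fix q p a assume qp: "(q, p) \<in> R" and a: "a < nA"
    then obtain t0 where t0: "t0 < m" "src t0 = q" "lt t0 = a" using total by (auto simp: R_def)
    then have "\<not> complete Ref t0 p"
      using invD(5)[OF inv] qp unfolding R_def by auto
    then obtain t where t: "t < m" "src t = q" "lt t = a" "(t, p) \<notin> Ref"
      using t0 by (auto simp: complete_def)
    have "wt u \<le> wt t \<and> (tgt t, tgt u) \<in> R" if u: "u < m" "src u = p" "lt u = a" for u
    proof -
      \<comment> \<open>The dummy entry ensures the weight comparison even if no position
        \<open>(tgt t, p)\<close> is ever won by Adam.\<close>
      have "(t, nQ) \<in> set qs" using invD(4)[OF inv] t by auto
      then have "\<not> wt t < wt u" using handled[of t nQ u] u t by (auto simp: refutes_def)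
      moreover have "(tgt t, tgt u) \<notin> B"
      proof
        assume "(tgt t, tgt u) \<in> B"
        then have "(t, tgt u) \<in> set qs" using invD(4)[OF inv] t by auto
        then show False using handled[of t "tgt u" u] u t by (auto simp: refutes_def)
      qed
      ultimately show ?thesis using tgt t u by (auto simp: R_def)
    qed
    then show "\<exists>t<m. src t = q \<and> lt t = a \<and>
        (\<forall>u<m. src u = p \<and> lt u = a \<longrightarrow> wt u \<le> wt t \<and> (tgt t, tgt u) \<in> R)"
      using t by blast
  qed
  then show "\<exists>R \<subseteq> {..<nQ} \<times> {..<nQ}. simulates R \<and> (i0, i0) \<in> R"
    using i0 init by (intro exI[of _ R]) (auto simp: R_def)
next
  assume "\<exists>R \<subseteq> {..<nQ} \<times> {..<nQ}. simulates R \<and> (i0, i0) \<in> R"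
  then show "(i0, i0) \<notin> B" using invD(6)[OF inv] by blast
qed

section \<open>Memory layout\<close>

definition base_R :: nat where "base_R = 4 * m + 4"
definition base_B :: nat where "base_B = base_R + m * nQ"
definition base_Q :: nat where "base_Q = base_B + nQ * nQ"

text \<open>The input (four header cells and four per transition) is followed by bit tables for
  \<open>Ref\<close> and \<open>B\<close> and finally by the queue, which alone grows. Memory beyond
  the input is initially zero, so both tables start out empty without being written.\<close>

definition mem_rep ::
    "(nat \<times> nat) set \<Rightarrow> (nat \<times> nat) set \<Rightarrow> (nat \<times> nat) list \<Rightarrow> (nat \<Rightarrow> nat) \<Rightarrow> bool" where
  "mem_rep Ref B qs mm \<longleftrightarrow>
     mm 1 = nQ \<and> mm 2 = i0 \<and> mm 3 = m \<and>
     (\<forall>t<m. mm (t * 4 + 4) = src t \<and> mm (t * 4 + 5) = lt t \<and> mm (t * 4 + 6) = wt t \<and>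
        mm (t * 4 + 7) = tgt t) \<and>
     (\<forall>t<m. \<forall>p<nQ. mm (t * nQ + p + base_R) = of_bool ((t, p) \<in> Ref)) \<and>
     (\<forall>q<nQ. \<forall>p<nQ. mm (q * nQ + p + base_B) = of_bool ((q, p) \<in> B)) \<and>
     (\<forall>k<length qs. mm (base_Q + 2 * k) = fst (qs ! k) \<and> mm (Suc (base_Q + 2 * k)) = snd (qs ! k))"

lemma index_less: "t < n \<Longrightarrow> p < k \<Longrightarrow> t * k + p < n * (k::nat)"
proof -
  assume "t < n" "p < k"
  then have "t * k + p < Suc t * k" by simp
  also have "\<dots> \<le> n * k" using \<open>t < n\<close> by (intro mult_le_mono1) simp
  finally show ?thesis .
qed

lemma index_eq_iff: "p < k \<Longrightarrow> p' < k \<Longrightarrow> t * k + p = t' * k + p' \<longleftrightarrow> t = t' \<and> p = (p'::nat)"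
proof -
  assume "p < k" "p' < k"
  then have "(t * k + p) div k = t" "(t' * k + p') div k = t'" by simp_all
  then show ?thesis by (metis add_left_cancel)
qed

lemma mem_rep_insert_Ref:
  assumes "mem_rep Ref B qs mm" "t < m" "p < nQ"
  shows "mem_rep (insert (t, p) Ref) B qs (mm(t * nQ + p + base_R := 1))"
proof -
  have "t' * nQ + p' + base_R = t * nQ + p + base_R \<longleftrightarrow> t' = t \<and> p' = p" if "p' < nQ" for t' p'
    using index_eq_iff[OF that assms(3)] by simp
  moreover have "x + base_B \<noteq> t * nQ + p + base_R" "base_Q + x \<noteq> t * nQ + p + base_R"
    "Suc (base_Q + x) \<noteq> t * nQ + p + base_R" for x
    using index_less[OF assms(2,3)] by (auto simp: base_B_def base_Q_def)
  moreover have "t' * 4 + i \<noteq> t * nQ + p + base_R" if "t' < m" "i < 8" for t' i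
    using that by (auto simp: base_R_def)
  moreover have "i \<noteq> t * nQ + p + base_R" if "i < 4" for i
    using that by (auto simp: base_R_def)
  ultimately show ?thesis
    using assms(1) by (simp add: mem_rep_def)
qed

lemma mem_rep_insert_B:
  assumes "mem_rep Ref B qs mm" "q < nQ" "p < nQ"
  shows "mem_rep Ref (insert (q, p) B) qs (mm(q * nQ + p + base_B := 1))"
proof -
  have "q' * nQ + p' + base_B = q * nQ + p + base_B \<longleftrightarrow> q' = q \<and> p' = p" if "p' < nQ" for q' p'
    using index_eq_iff[OF that assms(3)] by simp
  moreover have "t' * nQ + p' + base_R \<noteq> q * nQ + p + base_B" if "t' < m" "p' < nQ" for t' p'
    using index_less[OF that] by (auto simp: base_B_def)
  moreover have "base_Q + x \<noteq> q * nQ + p + base_B" "Suc (base_Q + x) \<noteq> q * nQ + p + base_B" for x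
    using index_less[OF assms(2,3)] by (auto simp: base_Q_def)
  moreover have "t' * 4 + i \<noteq> q * nQ + p + base_B" if "t' < m" "i < 8" for t' i
    using that by (auto simp: base_R_def base_B_def)
  moreover have "i \<noteq> q * nQ + p + base_B" if "i < 4" for i
    using that by (auto simp: base_R_def base_B_def)
  ultimately show ?thesis
    using assms(1) by (simp add: mem_rep_def)
qed

lemma mem_rep_push:
  assumes "mem_rep Ref B qs mm"
  shows "mem_rep Ref B (qs @ [(u, p)])
    (mm(base_Q + 2 * length qs := u, Suc (base_Q + 2 * length qs) := p))"
proof -
  have "t' * nQ + p' + base_R < base_Q" if "t' < m" "p' < nQ" for t' p'
    using index_less[OF that] by (auto simp: base_B_def base_Q_def)
  moreover have "q' * nQ + p' + base_B < base_Q" if "q' < nQ" "p' < nQ" for q' p'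
    using index_less[OF that] by (auto simp: base_Q_def)
  moreover have "t' * 4 + i < base_Q" if "t' < m" "i < 8" for t' i
    using that by (auto simp: base_R_def base_B_def base_Q_def)
  moreover have "i < base_Q" if "i < 4" for i
    using that by (auto simp: base_R_def base_B_def base_Q_def)
  moreover have "a < base_Q \<Longrightarrow>
      (mm(base_Q + 2 * length qs := u, Suc (base_Q + 2 * length qs) := p)) a = mm a" for a
    by auto
  moreover have "2 * k \<noteq> Suc (2 * l)" "Suc (2 * k) \<noteq> 2 * l" for k l :: nat
    by presburger+
  ultimately show ?thesis
    using assms by (auto simp: mem_rep_def nth_append less_Suc_eq simp del: fun_upd_apply)
      (auto simp: less_Suc_eq)
qed

end

section \<open>The program\<close>

text \<open>Register usage: 0 answer, and the constant 0 before that; 2 to 6 the constants \<open>m\<close>,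
  \<open>nQ\<close>, \<open>base_R\<close>, \<open>base_B\<close>, \<open>base_Q\<close>; 7 and 8 end and head of the queue;
  10 and 11 the current entry \<open>(t, p')\<close>; 12, 13, 14 letter, weight and source of \<open>t\<close>;
  15 the transition \<open>u\<close> of Adam; 17 its source; 21 counter of inner loops; 23 a flag;
  24 to 27 the offsets of the four fields of a transition; 28 the constant 1; 9, 16, 22 loop conditions;
  18, 19, 20 scratch.\<close>

definition load_field :: "reg \<Rightarrow> nat \<Rightarrow> reg \<Rightarrow> instr list" where
  "load_field i f d = [Mul d i 24, Add d d (24 + f), Load d d]"

text \<open>Register 19 becomes 1 exactly for a transition with the source and letter of
  \<open>t\<close> that is missing from \<open>Ref\<close>; subtracting it clears the flag, which
  then stays 0. In \<open>load_field\<close>, register 24 is both the record length and the offset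
  of field 0, as the header is as long as one record.\<close>

definition check_code :: com where
  "check_code = For 21 2 28 22 (Block (
     load_field 21 0 18 @ [Sub 19 18 14, Sub 20 14 18, Add 19 19 20] @
     load_field 21 1 18 @ [Sub 20 18 12, Add 19 19 20, Sub 20 12 18, Add 19 19 20,
       Mul 18 21 3, Add 18 18 17, Add 18 18 4, Load 20 18, Add 19 19 20,
       Sub 19 28 19, Sub 23 23 19]))"

definition push_code :: com where
  "push_code = For 21 2 28 22 (
     Block (load_field 21 3 18 @ [Sub 19 18 14, Sub 20 14 18, Add 19 19 20, Sub 19 28 19]) ;;
     When 19 (Block [Store 7 21, Add 7 7 28, Store 7 17, Add 7 7 28]))"

definition refute_code :: com where
  "refute_code =
     Block (load_field 15 0 17 @ load_field 15 1 18 @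
       [Sub 19 18 12, Sub 20 12 18, Add 19 19 20] @
       load_field 15 3 18 @ [Sub 20 18 11, Sub 18 11 18, Add 20 20 18] @
       load_field 15 2 18 @ [Sub 18 18 13, Sub 18 28 18, Mul 20 20 18, Add 19 19 20,
         Mul 18 10 3, Add 18 18 17, Add 18 18 4, Load 20 18, Add 19 19 20, Sub 19 28 19]) ;;
     When 19 (
       Block [Store 18 28, LoadConst 23 1] ;;
       check_code ;;
       Block [Mul 18 14 3, Add 18 18 17, Add 18 18 5, Load 20 18, Sub 23 23 20] ;;
       When 23 (Block [Store 18 28] ;; push_code))"

definition main_code :: com where
  "main_code =
     Block [LoadConst 28 1, LoadConst 24 4, LoadConst 25 5, LoadConst 26 6, LoadConst 27 7,
       LoadConst 18 3, Load 2 18, Load 3 28, Mul 4 2 24, Add 4 4 24, Mul 5 2 3, Add 5 4 5,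
       Mul 6 3 3, Add 6 5 6, Add 7 6 0, Add 8 6 0] ;;
     For 21 2 28 22 (Block [Store 7 21, Add 7 7 28, Store 7 3, Add 7 7 28]) ;;
     Block [Sub 9 7 8] ;;
     While 9 (
       Block ([Load 10 8, Add 8 8 28, Load 11 8, Add 8 8 28] @
         load_field 10 1 12 @ load_field 10 2 13 @ load_field 10 0 14) ;;
       For 15 2 28 16 refute_code ;;
       Block [Sub 9 7 8]) ;;
     Block [LoadConst 18 2, Load 18 18, Mul 19 18 3, Add 19 19 18, Add 19 19 5, Load 19 19,
       Sub 0 28 19]"

text \<open>The bound has room for \<open>m * (nQ + 2)\<close> queue entries of two cells each: a
  queue of at most \<open>m * (nQ + 1)\<close> entries, plus up to \<open>m\<close> that
  \<open>push_code\<close> appends before the invariant bounds the new length. The other summands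
  cover the intermediate values of comparisons.\<close>

locale bounded_game_instance = game_instance +
  fixes M :: nat
  assumes M_ge: "base_Q + 2 * (m * (nQ + 2)) + 2 * nA + 2 * nQ + 20 \<le> M"
begin

definition const_regs :: "(reg \<Rightarrow> nat) \<Rightarrow> bool" where
  "const_regs r \<longleftrightarrow> r 28 = 1 \<and> r 2 = m \<and> r 3 = nQ \<and> r 4 = base_R \<and> r 5 = base_B \<and> r 6 = base_Q \<and>
     r 24 = 4 \<and> r 25 = 5 \<and> r 26 = 6 \<and> r 27 = 7"

definition ctx :: "nat \<Rightarrow> nat \<Rightarrow> nat \<Rightarrow> nat \<Rightarrow> (nat \<times> nat) set \<Rightarrow> (nat \<times> nat) set \<Rightarrow>
    (nat \<times> nat) list \<Rightarrow> (reg \<Rightarrow> nat) \<Rightarrow> (nat \<Rightarrow> nat) \<Rightarrow> bool" where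
  "ctx h t p' u Ref B qs r mm \<longleftrightarrow>
     const_regs r \<and> r 7 = base_Q + 2 * length qs \<and> r 8 = base_Q + 2 * h \<and> r 10 = t \<and> r 11 = p' \<and>
     r 12 = lt t \<and> r 13 = wt t \<and> r 14 = src t \<and> r 15 = u \<and> mem_rep Ref B qs mm"

lemma ctx_upd [simp]:
  "d \<in> {9, 16, 17, 18, 19, 20, 21, 22, 23} \<Longrightarrow>
     ctx h t p' u Ref B qs (r(d := v)) mm \<longleftrightarrow> ctx h t p' u Ref B qs r mm"
  unfolding insert_iff empty_iff by (elim disjE) (simp_all add: ctx_def const_regs_def)

lemma ctxD:
  assumes "ctx h t p' u Ref B qs r mm"
  shows "r 28 = 1" "r 2 = m" "r 3 = nQ" "r 4 = base_R" "r 5 = base_B" "r 6 = base_Q"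
    "r 24 = 4" "r 25 = 5" "r 26 = 6" "r 27 = 7"
    "r 7 = base_Q + 2 * length qs" "r 8 = base_Q + 2 * h" "r 10 = t" "r 11 = p'" "r 12 = lt t"
    "r 13 = wt t" "r 14 = src t" "r 15 = u" "mem_rep Ref B qs mm"
  using assms by (simp_all add: ctx_def const_regs_def)

lemma mem_repD:
  assumes "mem_rep Ref B qs mm"
  shows "mm (Suc 0) = nQ" "mm 2 = i0" "mm 3 = m"
    "t < m \<Longrightarrow> mm (t * 4 + 4) = src t" "t < m \<Longrightarrow> mm (t * 4 + 5) = lt t"
    "t < m \<Longrightarrow> mm (t * 4 + 6) = wt t" "t < m \<Longrightarrow> mm (t * 4 + 7) = tgt t"
    "t < m \<Longrightarrow> p < nQ \<Longrightarrow> mm (t * nQ + p + base_R) = of_bool ((t, p) \<in> Ref)"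
    "q < nQ \<Longrightarrow> p < nQ \<Longrightarrow> mm (q * nQ + p + base_B) = of_bool ((q, p) \<in> B)"
    "k < length qs \<Longrightarrow> mm (base_Q + 2 * k) = fst (qs ! k)"
    "k < length qs \<Longrightarrow> mm (Suc (base_Q + 2 * k)) = snd (qs ! k)"
  using assms by (simp_all add: mem_rep_def)

lemma one_minus_eq_of_bool:
  fixes x :: nat
  assumes "x = 0 \<longleftrightarrow> b"
  shows "Suc 0 - x = of_bool b"
  using assms by (cases x) auto

lemma address_bounds:
  "t < m \<Longrightarrow> t * 4 + 7 \<le> M"
  "t < m \<Longrightarrow> p < nQ \<Longrightarrow> t * nQ + p + base_R \<le> M"
  "q < nQ \<Longrightarrow> p < nQ \<Longrightarrow> q * nQ + p + base_B \<le> M"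
  "k \<le> m * (nQ + 2) \<Longrightarrow> base_Q + 2 * k + 2 \<le> M"
  "2 * nA + 2 * nQ + 20 \<le> M"
proof -
  have B: "base_R \<le> base_B" "base_B \<le> base_Q" "4 * m + 4 = base_R" and M: "base_Q + 20 \<le> M"
    using M_ge by (simp_all add: base_R_def base_B_def base_Q_def)
  show "t * 4 + 7 \<le> M" if "t < m" using that B M by linarith
  show "t * nQ + p + base_R \<le> M" if "t < m" "p < nQ"
    using index_less[OF that] B(2) M by (simp add: base_B_def)
  show "q * nQ + p + base_B \<le> M" if "q < nQ" "p < nQ"
    using index_less[OF that] M by (simp add: base_Q_def)
  show "base_Q + 2 * k + 2 \<le> M" if "k \<le> m * (nQ + 2)"
    using that M_ge by linarith
  show "2 * nA + 2 * nQ + 20 \<le> M"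
    using M_ge by linarith
qed

lemma m_le_M: "m \<le> M"
  using M_ge by (simp add: base_R_def base_B_def base_Q_def)

lemma check_code_correct:
  assumes t: "t < m" and p: "p < nQ"
  shows "hoare M
    (\<lambda>k r mm. k \<le> K \<and> ctx h t p' u Ref B qs r mm \<and> r 17 = p \<and> r 23 = 1)
    check_code
    (\<lambda>k r mm. k \<le> K + 40 * m + 10 \<and> ctx h t p' u Ref B qs r mm \<and> r 17 = p \<and>
       r 23 = of_bool (complete Ref t p))"
proof -
  \<comment> \<open>An iteration takes twenty instructions and four steps of loop overhead; here and
    below, the constants are generous.\<close>
  define I where "I j k r mm \<longleftrightarrow> k \<le> K + 40 * j + 10 \<and> ctx h t p' u Ref B qs r mm \<and> r 17 = p \<and>
    r 23 = of_bool (\<forall>v<j. src v = src t \<and> lt v = lt t \<longrightarrow> (v, p) \<in> Ref)" for j k r mm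
  show ?thesis
    unfolding check_code_def
  proof (rule hoare_for[where I = I and N = m, OF m_le_M])
    fix j assume j: "j < m"
    show "hoare M (\<lambda>k r mm. I j k r mm \<and> r 21 = j \<and> r 22 = m - j)
      (Block (load_field 21 0 18 @ [Sub 19 18 14, Sub 20 14 18, Add 19 19 20] @
        load_field 21 1 18 @ [Sub 20 18 12, Add 19 19 20, Sub 20 12 18, Add 19 19 20,
        Mul 18 21 3, Add 18 18 17, Add 18 18 4, Load 20 18, Add 19 19 20,
        Sub 19 28 19, Sub 23 23 19]))
      (\<lambda>k r mm. r 21 = j \<and> r 28 = 1 \<and> r 2 = m \<and> I (Suc j) (k + 4) (r(21 := Suc j, 22 := m - Suc j)) mm)"
    proof (rule hoare_block)
      fix k r mm assume "I j k r mm \<and> r 21 = j \<and> r 22 = m - j"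
      then have k: "k \<le> K + 40 * j + 10" and c: "ctx h t p' u Ref B qs r mm" and r: "r 17 = p" "r 21 = j"
        and flag: "r 23 = of_bool (\<forall>v<j. src v = src t \<and> lt v = lt t \<longrightarrow> (v, p) \<in> Ref)"
        by (auto simp: I_def)
      define bit :: nat where "bit = of_bool ((j, p) \<in> Ref)"
      define fl :: nat where "fl = of_bool (\<forall>v<j. src v = src t \<and> lt v = lt t \<longrightarrow> (v, p) \<in> Ref)"
      note r = r flag[folded fl_def] ctxD(1-18)[OF c]
      note mm = mem_repD(4,5)[OF ctxD(19)[OF c] j] mem_repD(8)[OF ctxD(19)[OF c] j p, folded bit_def]
      \<comment> \<open>Sum of two absolute differences, zero iff source and letter both
        agree.\<close>
      define d where "d = src j - src t + (src t - src j) + (lt j - lt t) + (lt t - lt j)"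
      have "d + bit \<le> M" "src j - src t + (src t - src j) + (lt j - lt t) \<le> d"
        "src j - src t + (src t - src j) \<le> d"
        using src[OF j] src[OF t] lt[OF j] lt[OF t] address_bounds(5)
        by (auto simp: d_def bit_def)
      note b = this address_bounds(1)[OF j] address_bounds(2)[OF j p]
      have "d = 0 \<longleftrightarrow> src j = src t \<and> lt j = lt t" by (auto simp: d_def)
      then have val: "fl - (Suc 0 - (d + bit)) =
          of_bool (\<forall>v<Suc j. src v = src t \<and> lt v = lt t \<longrightarrow> (v, p) \<in> Ref)"
        by (cases "d = 0") (auto simp: fl_def bit_def All_less_Suc)
      show "wp M (load_field 21 0 18 @ [Sub 19 18 14, Sub 20 14 18, Add 19 19 20] @
        load_field 21 1 18 @ [Sub 20 18 12, Add 19 19 20, Sub 20 12 18, Add 19 19 20,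
        Mul 18 21 3, Add 18 18 17, Add 18 18 4, Load 20 18, Add 19 19 20,
        Sub 19 28 19, Sub 23 23 19])
        (\<lambda>k r mm. r 21 = j \<and> r 28 = 1 \<and> r 2 = m \<and> I (Suc j) (k + 4) (r(21 := Suc j, 22 := m - Suc j)) mm) k r mm"
        using b k c
        by (simp add: load_field_def r mm I_def val flip: d_def)
    qed
  qed (auto simp: I_def complete_def dest: ctxD)
qed

lemma ctx_push:
  assumes "ctx h t p' u Ref B qs r mm"
  shows "ctx h t p' u Ref B (qs @ [(v, p)]) (r(7 := Suc (Suc (base_Q + 2 * length qs))))
    (mm(base_Q + 2 * length qs := v, Suc (base_Q + 2 * length qs) := p))"
  using assms mem_rep_push[of Ref B qs mm v p]
  by (simp add: ctx_def const_regs_def del: fun_upd_apply) simp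

lemma push_code_correct:
  assumes t: "t < m" and p: "p < nQ" and len: "length qs \<le> m * (nQ + 1)"
  shows "hoare M
    (\<lambda>k r mm. k \<le> K \<and> ctx h t p' u Ref B qs r mm \<and> r 17 = p)
    push_code
    (\<lambda>k r mm. k \<le> K + 40 * m + 10 \<and> ctx h t p' u Ref B (qs @ edges_to (src t) p) r mm)"
proof -
  define es where "es j = qs @ map (\<lambda>v. (v, p)) (filter (\<lambda>v. tgt v = src t) [0..<j])" for j
  define I where "I j k r mm \<longleftrightarrow>
    k \<le> K + 40 * j + 10 \<and> ctx h t p' u Ref B (es j) r mm \<and> r 17 = p" for j k r mm
  show ?thesis
    unfolding push_code_def
  proof (rule hoare_for[where I = I and N = m, OF m_le_M])
    fix j assume j: "j < m"
    define d where "d = tgt j - src t + (src t - tgt j)"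
    have d: "d = 0 \<longleftrightarrow> tgt j = src t" "d \<le> M"
      using src[OF t] tgt[OF j] address_bounds(5) by (auto simp: d_def)
    let ?Q = "\<lambda>k r mm. k \<le> K + 40 * j + 20 \<and> ctx h t p' u Ref B (es j) r mm \<and>
      r 17 = p \<and> r 21 = j \<and> r 19 = of_bool (tgt j = src t)"
    let ?R = "\<lambda>k r mm. r 21 = j \<and> r 28 = 1 \<and> r 2 = m \<and>
      I (Suc j) (k + 4) (r(21 := Suc j, 22 := m - Suc j)) mm"
    show "hoare M (\<lambda>k r mm. I j k r mm \<and> r 21 = j \<and> r 22 = m - j)
      (Block (load_field 21 3 18 @ [Sub 19 18 14, Sub 20 14 18, Add 19 19 20, Sub 19 28 19]) ;;
       When 19 (Block [Store 7 21, Add 7 7 28, Store 7 17, Add 7 7 28])) ?R"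
    proof (rule hoare_block_seq[where Q = ?Q])
      fix k r mm assume "I j k r mm \<and> r 21 = j \<and> r 22 = m - j"
      then have k: "k \<le> K + 40 * j + 10" and c: "ctx h t p' u Ref B (es j) r mm"
        and r: "r 17 = p" "r 21 = j"
        by (auto simp: I_def)
      show "wp M (load_field 21 3 18 @ [Sub 19 18 14, Sub 20 14 18, Add 19 19 20, Sub 19 28 19])
          ?Q k r mm"
        using k c d(2) address_bounds(1)[OF j]
        by (simp add: load_field_def r ctxD(1-18)[OF c] mem_repD(7)[OF ctxD(19)[OF c] j] I_def
            one_minus_eq_of_bool[OF d(1)] flip: d_def)
    next
      show "hoare M ?Q (When 19 (Block [Store 7 21, Add 7 7 28, Store 7 17, Add 7 7 28])) ?R"
      proof (rule hoare_when)
        fix k r mm assume "?Q k r mm" "r 19 = 0"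
        then show "?R (Suc k) r mm"
          by (auto simp: I_def es_def dest: ctxD)
      next
        show "hoare M (\<lambda>k r mm. \<exists>k0. k = Suc k0 \<and> ?Q k0 r mm \<and> r 19 \<noteq> 0)
          (Block [Store 7 21, Add 7 7 28, Store 7 17, Add 7 7 28]) ?R"
        proof (rule hoare_block)
          fix k r mm assume *: "\<exists>k0. k = Suc k0 \<and> ?Q k0 r mm \<and> r 19 \<noteq> 0"
          then have k: "k \<le> K + 40 * j + 25" and c: "ctx h t p' u Ref B (es j) r mm"
            and r: "r 17 = p" "r 21 = j" and e: "tgt j = src t"
            by (auto simp: I_def)
          have es: "es (Suc j) = es j @ [(j, p)]" using e by (simp add: es_def)
          have "length (filter (\<lambda>v. tgt v = src t) [0..<j]) \<le> j"
            using length_filter_le[of "\<lambda>v. tgt v = src t" "[0..<j]"] by simp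
          then have "length (es j) \<le> m * (nQ + 2)" using len j by (simp add: es_def)
          from address_bounds(4)[OF this]
          show "wp M [Store 7 21, Add 7 7 28, Store 7 17, Add 7 7 28] ?R k r mm"
            using k ctx_push[OF c, of j p]
            by (simp add: r ctxD(1-18)[OF c] I_def es)
        qed
      qed
    qed
  qed (auto simp: I_def es_def edges_to_def dest: ctxD)
qed

lemma ctx_insert_Ref:
  assumes "ctx h t p' u Ref B qs r mm" "t < m" "p < nQ"
  shows "ctx h t p' u (insert (t, p) Ref) B qs r (mm(t * nQ + p + base_R := Suc 0))"
  using assms mem_rep_insert_Ref[of Ref B qs mm t p]
  by (simp add: ctx_def del: fun_upd_apply)

lemma ctx_insert_B:
  assumes "ctx h t p' u Ref B qs r mm" "q < nQ" "p < nQ"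
  shows "ctx h t p' u Ref (insert (q, p) B) qs r (mm(q * nQ + p + base_B := Suc 0))"
  using assms mem_rep_insert_B[of Ref B qs mm q p]
  by (simp add: ctx_def del: fun_upd_apply)

text \<open>Amortised cost: without a new pair the code takes constant time. A new pair raises
  \<open>card Ref\<close> by one, and this increase pays \<open>100 * (m + 1)\<close> steps, enough
  for the two scans in \<open>check_code\<close> and \<open>push_code\<close>.\<close>

lemma refute_code_correct:
  assumes inv: "algorithm_inv Ref B qs" and tp': "(t, p') \<in> set qs" and u: "u < m"
  shows "hoare M
    (\<lambda>k r mm. k \<le> K + 100 * (m + 1) * card Ref \<and> ctx h t p' u Ref B qs r mm)
    refute_code
    (\<lambda>k r mm. \<exists>Ref' B' zs. algorithm_inv Ref' B' (qs @ zs) \<and> Ref \<subseteq> Ref' \<and>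
       (refutes t p' u \<longrightarrow> (t, src u) \<in> Ref') \<and>
       k \<le> K + 60 + 100 * (m + 1) * card Ref' \<and> ctx h t p' u Ref' B' (qs @ zs) r mm)"
    (is "hoare M ?P refute_code ?Post")
proof -
  have t: "t < m" and p': "p' \<le> nQ" using inv_bounds(4)[OF inv] tp' by auto
  define p where "p = src u"
  have p: "p < nQ" using src[OF u] by (simp add: p_def)
  define Ref' where "Ref' = insert (t, p) Ref"
  have inv_B: "algorithm_inv Ref' (insert (src t, p) B) (qs @ edges_to (src t) p)"
    if "complete Ref' t p" "(src t, p) \<notin> B" "refutes t p' u"
    using inv_refute(1)[OF inv t tp' u that(3)] that by (simp add: p_def Ref'_def)
  have inv_same: "algorithm_inv Ref' B qs"
    if "\<not> (complete Ref' t p \<and> (src t, p) \<notin> B)" "refutes t p' u"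
    using inv_refute(2)[OF inv t tp' u that(2)] that by (simp add: p_def Ref'_def)
  define K1 where "K1 = K + 100 * (m + 1) * card Ref"
  have K1: "K1 + 100 * m + 100 = K + 100 * (m + 1) * card Ref'" if "(t, p) \<notin> Ref"
    using that inv_bounds(1)[OF inv] by (simp add: K1_def Ref'_def)
  let ?new = "refutes t p' u \<and> (t, p) \<notin> Ref"
  let ?Q1 = "\<lambda>k r mm. k \<le> K1 + 50 \<and> ctx h t p' u Ref B qs r mm \<and> r 17 = p \<and>
    r 18 = t * nQ + p + base_R \<and> r 19 = of_bool ?new"
  let ?Q2 = "\<lambda>k r mm. k \<le> K1 + 55 \<and> ctx h t p' u Ref' B qs r mm \<and> r 17 = p \<and> r 23 = 1"
  let ?Q3 = "\<lambda>k r mm. k \<le> (K1 + 55) + 40 * m + 10 \<and> ctx h t p' u Ref' B qs r mm \<and> r 17 = p \<and>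
    r 23 = of_bool (complete Ref' t p)"
  let ?Q4 = "\<lambda>k r mm. k \<le> K1 + 75 + 40 * m \<and> ctx h t p' u Ref' B qs r mm \<and> r 17 = p \<and>
    r 18 = src t * nQ + p + base_B \<and> r 23 = of_bool (complete Ref' t p \<and> (src t, p) \<notin> B)"
  let ?Q5 = "\<lambda>k r mm. k \<le> K1 + 80 + 40 * m \<and>
    ctx h t p' u Ref' (insert (src t, p) B) qs r mm \<and> r 17 = p"
  let ?Q6 = "\<lambda>k r mm. k \<le> (K1 + 80 + 40 * m) + 40 * m + 10 \<and>
    ctx h t p' u Ref' (insert (src t, p) B) (qs @ edges_to (src t) p) r mm"
  let ?L = "load_field 15 0 17 @ load_field 15 1 18 @
       [Sub 19 18 12, Sub 20 12 18, Add 19 19 20] @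
       load_field 15 3 18 @ [Sub 20 18 11, Sub 18 11 18, Add 20 20 18] @
       load_field 15 2 18 @ [Sub 18 18 13, Sub 18 28 18, Mul 20 20 18, Add 19 19 20,
         Mul 18 10 3, Add 18 18 17, Add 18 18 4, Load 20 18, Add 19 19 20, Sub 19 28 19]"
  have L: "wp M ?L ?Q1 k r mm" if P: "?P k r mm" for k r mm
  proof -
    from P have k: "k \<le> K1" and c: "ctx h t p' u Ref B qs r mm" by (simp_all add: K1_def)
    define bit :: nat where "bit = of_bool ((t, p) \<in> Ref)"
    note mm = mem_repD(4-7)[OF ctxD(19)[OF c] u, folded p_def]
      mem_repD(8)[OF ctxD(19)[OF c] t p, folded bit_def]
    \<comment> \<open>\<open>d1\<close> and \<open>d2\<close> are zero iff the letters, respectively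
      \<open>tgt u\<close> and \<open>p'\<close>, agree, and \<open>w\<close> is zero iff
      \<open>u\<close> has the larger weight. The product is the disjunction in
      \<open>refutes\<close>; adding \<open>bit\<close> demands that the pair be new. For a dummy
      entry \<open>d2\<close> never vanishes.\<close>
    define d1 where "d1 = lt u - lt t + (lt t - lt u)"
    define d2 where "d2 = tgt u - p' + (p' - tgt u)"
    define w where "w = Suc 0 - (wt u - wt t)"
    have d: "d1 \<le> nA" "d2 \<le> nQ" "w \<le> 1" "bit \<le> 1"
      using lt[OF t] lt[OF u] tgt[OF u] p' by (auto simp: d1_def d2_def w_def bit_def)
    then have "d2 * w \<le> nQ * 1" by (intro mult_le_mono)
    then have b: "d1 \<le> M" "d2 \<le> M" "d2 * w \<le> M" "d1 + d2 * w \<le> M" "d1 + d2 * w + bit \<le> M"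
      using d address_bounds(5) by linarith+
    have "d1 = 0 \<longleftrightarrow> lt u = lt t" "d2 = 0 \<longleftrightarrow> tgt u = p'" "w = 0 \<longleftrightarrow> wt t < wt u"
      using wt[OF t] wt[OF u] by (auto simp: d1_def d2_def w_def)
    then have "d1 + d2 * w + bit = 0 \<longleftrightarrow> ?new" by (auto simp: refutes_def bit_def)
    note val = one_minus_eq_of_bool[OF this]
    show ?thesis
      using b k c address_bounds(1)[OF u] address_bounds(2)[OF t p]
      by (simp add: load_field_def ctxD(1-18)[OF c] mm val flip: d1_def d2_def w_def)
  qed
  have else1: "?Post (Suc k) r mm" if Q: "?Q1 k r mm" and z: "r 19 = 0" for k r mm
  proof -
    have "refutes t p' u \<longrightarrow> (t, src u) \<in> Ref" using Q z by (simp add: p_def)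
    then show ?thesis
      using Q inv by (intro exI[of _ Ref] exI[of _ B] exI[of _ "[]"]) (simp add: K1_def)
  qed
  have then1: "hoare M (\<lambda>k r mm. \<exists>k0. k = Suc k0 \<and> ?Q1 k0 r mm \<and> r 19 \<noteq> 0)
    (Block [Store 18 28, LoadConst 23 1] ;;
      check_code ;;
      Block [Mul 18 14 3, Add 18 18 17, Add 18 18 5, Load 20 18, Sub 23 23 20] ;;
      When 23 (Block [Store 18 28] ;; push_code)) ?Post"
  proof (cases ?new)
    case False
    \<comment> \<open>Register 19 is zero in this case, so the precondition is
      contradictory.\<close>
    then show ?thesis unfolding hoare_def by auto
  next
    case new: True
    have srct: "src t < nQ" using src[OF t] .
    show ?thesis
    proof (rule hoare_block_seq[OF _ hoare_seq[OF check_code_correct[OF t p]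
            hoare_block_seq[where Q = ?Q4, OF _ hoare_when]]])
      fix k r mm assume "\<exists>k0. k = Suc k0 \<and> ?Q1 k0 r mm \<and> r 19 \<noteq> 0"
      then have k: "k \<le> K1 + 51" and c: "ctx h t p' u Ref B qs r mm"
        and r: "r 17 = p" "r 18 = t * nQ + p + base_R" by auto
      show "wp M [Store 18 28, LoadConst 23 1] ?Q2 k r mm"
        using k ctx_insert_Ref[OF c t p] address_bounds(5)
        by (simp add: r ctxD(1-18)[OF c] Ref'_def)
    next
      fix k r mm assume Q: "?Q3 k r mm"
      then have k: "k \<le> (K1 + 55) + 40 * m + 10" and c: "ctx h t p' u Ref' B qs r mm"
        and r: "r 17 = p" and flag: "r 23 = of_bool (complete Ref' t p)" by auto
      show "wp M [Mul 18 14 3, Add 18 18 17, Add 18 18 5, Load 20 18, Sub 23 23 20] ?Q4 k r mm"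
        using k c address_bounds(3)[OF srct p]
        by (simp add: r flag ctxD(1-18)[OF c] mem_repD(9)[OF ctxD(19)[OF c] srct p])
    next
      fix k r mm assume Q: "?Q4 k r mm" "r 23 = 0"
      then have "algorithm_inv Ref' B qs" using inv_same new by simp
      then show "?Post (Suc k) r mm"
        using Q new K1 by (intro exI[of _ Ref'] exI[of _ B] exI[of _ "[]"]) (auto simp: p_def Ref'_def)
    next
      show "hoare M (\<lambda>k r mm. \<exists>k0. k = Suc k0 \<and> ?Q4 k0 r mm \<and> r 23 \<noteq> 0)
        (Block [Store 18 28] ;; push_code) ?Post"
      proof (cases "complete Ref' t p \<and> (src t, p) \<notin> B")
        case False
        then show ?thesis unfolding hoare_def by auto
      next
        case True
        then have inv': "algorithm_inv Ref' (insert (src t, p) B) (qs @ edges_to (src t) p)"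
          using inv_B new by blast
        show ?thesis
        proof (rule hoare_block_seq[where Q = ?Q5])
          fix k r mm assume "\<exists>k0. k = Suc k0 \<and> ?Q4 k0 r mm \<and> r 23 \<noteq> 0"
          then have k: "k \<le> K1 + 76 + 40 * m" and c: "ctx h t p' u Ref' B qs r mm"
            and r: "r 17 = p" "r 18 = src t * nQ + p + base_B" by auto
          show "wp M [Store 18 28] ?Q5 k r mm"
            using k ctx_insert_B[OF c srct p] by (simp add: r ctxD(1-18)[OF c])
        next
          show "hoare M ?Q5 push_code ?Post"
          proof (rule hoare_post[OF push_code_correct[OF t p]])
            show "length qs \<le> m * (nQ + 1)" using inv_bounds(3)[OF inv] .
            fix k r mm assume Q: "?Q6 k r mm"
            have "k \<le> K + 60 + 100 * (m + 1) * card Ref'" using Q K1 new by linarith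
            then show "?Post k r mm"
              using Q inv'
              by (intro exI[of _ Ref'] exI[of _ "insert (src t, p) B"]
                  exI[of _ "edges_to (src t) p"]) (auto simp: p_def Ref'_def)
          qed
        qed
      qed
    qed
  qed
  show ?thesis
    unfolding refute_code_def
    by (rule hoare_block_seq[where Q = ?Q1, OF L hoare_when[OF then1 else1]])
qed

definition ctx0 :: "nat \<Rightarrow> (nat \<times> nat) set \<Rightarrow> (nat \<times> nat) set \<Rightarrow> (nat \<times> nat) list \<Rightarrow>
    (reg \<Rightarrow> nat) \<Rightarrow> (nat \<Rightarrow> nat) \<Rightarrow> bool" where
  "ctx0 h Ref B qs r mm \<longleftrightarrow>
     const_regs r \<and> r 7 = base_Q + 2 * length qs \<and> r 8 = base_Q + 2 * h \<and> mem_rep Ref B qs mm"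

lemma ctx_iff:
  "ctx h t p' u Ref B qs r mm \<longleftrightarrow> ctx0 h Ref B qs r mm \<and>
     r 10 = t \<and> r 11 = p' \<and> r 12 = lt t \<and> r 13 = wt t \<and> r 14 = src t \<and> r 15 = u"
  by (auto simp: ctx_def ctx0_def)

lemma ctx0_upd [simp]:
  "d \<in> {9..23} \<Longrightarrow> ctx0 h Ref B qs (r(d := v)) mm \<longleftrightarrow> ctx0 h Ref B qs r mm"
  by (auto simp: ctx0_def const_regs_def)

lemma ctx0D:
  assumes "ctx0 h Ref B qs r mm"
  shows "r 2 = m" "r 3 = nQ" "r 4 = base_R" "r 5 = base_B" "r 6 = base_Q"
    "r 24 = 4" "r 25 = 5" "r 26 = 6" "r 27 = 7" "r 28 = 1"
    "r 7 = base_Q + 2 * length qs" "r 8 = base_Q + 2 * h" "mem_rep Ref B qs mm"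
  using assms by (simp_all add: ctx0_def const_regs_def)

lemma pop_code_correct:
  assumes t: "t < m"
  shows "hoare M
    (\<lambda>k r mm. \<exists>Ref B qs. algorithm_inv Ref B qs \<and> handled Ref qs h \<and> h < length qs \<and> qs ! h = (t, p') \<and>
       k \<le> K + 100 * (m + 1) * card Ref \<and> ctx (Suc h) t p' (r 15) Ref B qs r mm)
    (For 15 2 28 16 refute_code)
    (\<lambda>k r mm. \<exists>Ref B qs. algorithm_inv Ref B qs \<and> handled Ref qs (Suc h) \<and> h < length qs \<and>
       k \<le> K + 70 * m + 10 + 100 * (m + 1) * card Ref \<and> ctx0 (Suc h) Ref B qs r mm)"
proof -
  define I where "I j k r mm \<longleftrightarrow> (\<exists>Ref B qs. algorithm_inv Ref B qs \<and> handled Ref qs h \<and> h < length qs \<and>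
       qs ! h = (t, p') \<and> (\<forall>u<j. refutes t p' u \<longrightarrow> (t, src u) \<in> Ref) \<and>
       k \<le> K + 70 * j + 10 + 100 * (m + 1) * card Ref \<and> ctx (Suc h) t p' (r 15) Ref B qs r mm)"
    for j k r mm
  show ?thesis
  proof (rule hoare_for[where I = I and N = m, OF m_le_M])
    fix k r mm
    assume "\<exists>Ref B qs. algorithm_inv Ref B qs \<and> handled Ref qs h \<and> h < length qs \<and> qs ! h = (t, p') \<and>
       k \<le> K + 100 * (m + 1) * card Ref \<and> ctx (Suc h) t p' (r 15) Ref B qs r mm"
    then obtain Ref B qs where *: "algorithm_inv Ref B qs" "handled Ref qs h" "h < length qs"
      "qs ! h = (t, p')" "k \<le> K + 100 * (m + 1) * card Ref"
      "ctx (Suc h) t p' (r 15) Ref B qs r mm" by blast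
    have "I 0 (k + 3) (r(15 := 0, 16 := m)) mm"
      unfolding I_def using * by (intro exI[of _ Ref] exI[of _ B] exI[of _ qs]) (simp add: ctx_iff)
    then show "r 2 = m \<and> I 0 (k + 3) (r(15 := 0, 16 := m)) mm"
      using ctxD(2)[OF *(6)] by simp
  next
    fix j assume j: "j < m"
    show "hoare M (\<lambda>k r mm. I j k r mm \<and> r 15 = j \<and> r 16 = m - j) refute_code
      (\<lambda>k r mm. r 15 = j \<and> r 28 = 1 \<and> r 2 = m \<and> I (Suc j) (k + 4) (r(15 := Suc j, 16 := m - Suc j)) mm)"
    \<comment> \<open>The loop invariant hides \<open>Ref\<close>, \<open>B\<close> and
      \<open>qs\<close> under existentials, whereas the triple for \<open>refute_code\<close> needs
      them fixed.\<close>
    proof (rule hoare_local)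
      fix k r mm assume "I j k r mm \<and> r 15 = j \<and> r 16 = m - j"
      then obtain Ref B qs where *: "algorithm_inv Ref B qs" "handled Ref qs h" "h < length qs"
        "qs ! h = (t, p')" "\<forall>u<j. refutes t p' u \<longrightarrow> (t, src u) \<in> Ref"
        "k \<le> (K + 70 * j + 10) + 100 * (m + 1) * card Ref"
        "ctx (Suc h) t p' j Ref B qs r mm" unfolding I_def by auto
      have tp': "(t, p') \<in> set qs" using *(3,4) by (metis nth_mem)
      show "\<exists>P'. P' k r mm \<and> hoare M P' refute_code (\<lambda>k r mm. r 15 = j \<and> r 28 = 1 \<and> r 2 = m \<and>
          I (Suc j) (k + 4) (r(15 := Suc j, 16 := m - Suc j)) mm)"
      proof (intro exI conjI)
        show "k \<le> (K + 70 * j + 10) + 100 * (m + 1) * card Ref \<and> ctx (Suc h) t p' j Ref B qs r mm"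
          using *(6,7) by blast
        show "hoare M (\<lambda>k r mm. k \<le> (K + 70 * j + 10) + 100 * (m + 1) * card Ref \<and>
            ctx (Suc h) t p' j Ref B qs r mm) refute_code
          (\<lambda>k r mm. r 15 = j \<and> r 28 = 1 \<and> r 2 = m \<and>
            I (Suc j) (k + 4) (r(15 := Suc j, 16 := m - Suc j)) mm)"
        proof (rule hoare_post[OF refute_code_correct[OF *(1) tp' j]])
          fix k r mm
          assume "\<exists>Ref' B' zs. algorithm_inv Ref' B' (qs @ zs) \<and> Ref \<subseteq> Ref' \<and>
            (refutes t p' j \<longrightarrow> (t, src j) \<in> Ref') \<and>
            k \<le> K + 70 * j + 10 + 60 + 100 * (m + 1) * card Ref' \<and>
            ctx (Suc h) t p' j Ref' B' (qs @ zs) r mm"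
          then obtain Ref' B' zs where R: "algorithm_inv Ref' B' (qs @ zs)" "Ref \<subseteq> Ref'"
            "refutes t p' j \<longrightarrow> (t, src j) \<in> Ref'"
            "k \<le> K + 70 * j + 10 + 60 + 100 * (m + 1) * card Ref'"
            "ctx (Suc h) t p' j Ref' B' (qs @ zs) r mm" by blast
          have "\<forall>u<Suc j. refutes t p' u \<longrightarrow> (t, src u) \<in> Ref'"
            using R(2,3) *(5) by (auto simp: less_Suc_eq)
          then have "I (Suc j) (k + 4) (r(15 := Suc j, 16 := m - Suc j)) mm"
            unfolding I_def using R handled_append[OF *(2) R(2), of zs] *(3,4)
            by (intro exI[of _ Ref'] exI[of _ B'] exI[of _ "qs @ zs"])
              (simp add: ctx_iff nth_append)
          then show "r 15 = j \<and> r 28 = 1 \<and> r 2 = m \<and>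
              I (Suc j) (k + 4) (r(15 := Suc j, 16 := m - Suc j)) mm"
            using ctxD[OF R(5)] by simp
        qed
      qed
    qed
  next
    fix k r mm assume "I m k r mm"
    then obtain Ref B qs where *: "algorithm_inv Ref B qs" "handled Ref qs h" "h < length qs"
        "qs ! h = (t, p')" "\<forall>u<m. refutes t p' u \<longrightarrow> (t, src u) \<in> Ref"
        "k \<le> K + 70 * m + 10 + 100 * (m + 1) * card Ref"
        "ctx (Suc h) t p' (r 15) Ref B qs r mm" unfolding I_def by auto
    then show "\<exists>Ref B qs. algorithm_inv Ref B qs \<and> handled Ref qs (Suc h) \<and> h < length qs \<and>
       k \<le> K + 70 * m + 10 + 100 * (m + 1) * card Ref \<and> ctx0 (Suc h) Ref B qs r mm"
      using handled_Suc[OF *(2-4)]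
      by (intro exI[of _ Ref] exI[of _ B] exI[of _ qs]) (simp add: ctx_iff)
  qed simp_all
qed

lemma init_code_correct:
  "hoare M (\<lambda>k r mm. k = 0 \<and> r 0 = 0 \<and> mem_rep {} {} [] mm)
    (Block [LoadConst 28 1, LoadConst 24 4, LoadConst 25 5, LoadConst 26 6, LoadConst 27 7,
       LoadConst 18 3, Load 2 18, Load 3 28, Mul 4 2 24, Add 4 4 24, Mul 5 2 3, Add 5 4 5,
       Mul 6 3 3, Add 6 5 6, Add 7 6 0, Add 8 6 0])
    (\<lambda>k r mm. k \<le> 20 \<and> ctx0 0 {} {} [] r mm)"
proof (rule hoare_block)
  fix k :: nat and r mm :: "nat \<Rightarrow> nat" assume *: "k = 0 \<and> r 0 = 0 \<and> mem_rep {} {} [] mm"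
  have "m * 4 \<le> M" "m * 4 + 4 \<le> M" "m * nQ \<le> M" "m * 4 + 4 + m * nQ \<le> M" "nQ * nQ \<le> M"
    "m * 4 + 4 + m * nQ + nQ * nQ \<le> M" "7 \<le> M"
    using M_ge by (simp_all add: base_R_def base_B_def base_Q_def)
  then show "wp M [LoadConst 28 1, LoadConst 24 4, LoadConst 25 5, LoadConst 26 6, LoadConst 27 7,
       LoadConst 18 3, Load 2 18, Load 3 28, Mul 4 2 24, Add 4 4 24, Mul 5 2 3, Add 5 4 5,
       Mul 6 3 3, Add 6 5 6, Add 7 6 0, Add 8 6 0] (\<lambda>k r mm. k \<le> 20 \<and> ctx0 0 {} {} [] r mm) k r mm"
    using * mem_repD(1,3)[of "{}" "{}" "[]" mm]
    by (simp add: ctx0_def const_regs_def base_R_def base_B_def base_Q_def mult.commute)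
qed

lemma ctx0_push:
  assumes "ctx0 h Ref B qs r mm"
  shows "ctx0 h Ref B (qs @ [(v, p)]) (r(7 := Suc (Suc (base_Q + 2 * length qs))))
    (mm(base_Q + 2 * length qs := v, Suc (base_Q + 2 * length qs) := p))"
  using assms mem_rep_push[of Ref B qs mm v p]
  by (simp add: ctx0_def const_regs_def del: fun_upd_apply) simp

lemma fill_code_correct:
  "hoare M (\<lambda>k r mm. k \<le> 20 \<and> ctx0 0 {} {} [] r mm)
    (For 21 2 28 22 (Block [Store 7 21, Add 7 7 28, Store 7 3, Add 7 7 28]))
    (\<lambda>k r mm. k \<le> 30 + 20 * m \<and> ctx0 0 {} {} (map (\<lambda>u. (u, nQ)) [0..<m]) r mm)"
proof -
  define I where "I j k r mm \<longleftrightarrow>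
    k \<le> 30 + 20 * j \<and> ctx0 0 {} {} (map (\<lambda>u. (u, nQ)) [0..<j]) r mm" for j k r mm
  show ?thesis
  proof (rule hoare_for[where I = I and N = m, OF m_le_M])
    fix j assume j: "j < m"
    show "hoare M (\<lambda>k r mm. I j k r mm \<and> r 21 = j \<and> r 22 = m - j)
      (Block [Store 7 21, Add 7 7 28, Store 7 3, Add 7 7 28])
      (\<lambda>k r mm. r 21 = j \<and> r 28 = 1 \<and> r 2 = m \<and> I (Suc j) (k + 4) (r(21 := Suc j, 22 := m - Suc j)) mm)"
    proof (rule hoare_block)
      fix k r mm assume "I j k r mm \<and> r 21 = j \<and> r 22 = m - j"
      then have k: "k \<le> 30 + 20 * j" and c: "ctx0 0 {} {} (map (\<lambda>u. (u, nQ)) [0..<j]) r mm"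
        and r: "r 21 = j" by (auto simp: I_def)
      have "length (map (\<lambda>u. (u, nQ)) [0..<j]) \<le> m * (nQ + 2)" using j by simp
      from address_bounds(4)[OF this]
      show "wp M [Store 7 21, Add 7 7 28, Store 7 3, Add 7 7 28]
        (\<lambda>k r mm. r 21 = j \<and> r 28 = 1 \<and> r 2 = m \<and>
          I (Suc j) (k + 4) (r(21 := Suc j, 22 := m - Suc j)) mm) k r mm"
        using k ctx0_push[OF c, of j nQ]
        by (simp add: r ctx0D(1-12)[OF c] I_def)
    qed
  qed (auto simp: I_def dest: ctx0D)
qed

lemma main_code_correct:
  "hoare M (\<lambda>k r mm. k = 0 \<and> r 0 = 0 \<and> mem_rep {} {} [] mm)
    main_code
    (\<lambda>k r mm. k \<le> 400 * ((m + 1) * ((m + 1) * (nQ + 1))) \<and>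
       r 0 = of_bool (\<exists>R \<subseteq> {..<nQ} \<times> {..<nQ}. simulates R \<and> (i0, i0) \<in> R))"
proof -
  \<comment> \<open>Initialisation, then \<open>200 * (m + 1)\<close> steps for each of the
    \<open>h\<close> processed entries, and the potential for the pairs in
    \<open>Ref\<close>.\<close>
  define T where "T h Ref = 40 + 20 * m + 200 * (m + 1) * h + 100 * (m + 1) * card Ref"
    for h and Ref :: "(nat \<times> nat) set"
  define J where "J k r mm \<longleftrightarrow> (\<exists>h Ref B qs. algorithm_inv Ref B qs \<and> handled Ref qs h \<and> ctx0 h Ref B qs r mm \<and>
    r 9 = 2 * length qs - 2 * h \<and> k \<le> T h Ref)" for k r mm
  \<comment> \<open>The number of waiting entries need not decrease, since rounds append to the
    queue. The distance of the head from the largest possible end of the queue does.\<close>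
  define f where "f r = base_Q + 2 * (m * (nQ + 1)) - r 8" for r :: "reg \<Rightarrow> nat"
  let ?B1 = "[Load 10 8, Add 8 8 28, Load 11 8, Add 8 8 28] @
         load_field 10 1 12 @ load_field 10 2 13 @ load_field 10 0 14"
  let ?B2 = "[LoadConst 18 2, Load 18 18, Mul 19 18 3, Add 19 19 18, Add 19 19 5, Load 19 19,
       Sub 0 28 19]"
  have body: "hoare M (\<lambda>k r mm. J k r mm \<and> r 9 \<noteq> 0 \<and> f r = x)
    (Block ?B1 ;; For 15 2 28 16 refute_code ;; Block [Sub 9 7 8])
    (\<lambda>k r mm. J (k + 2) r mm \<and> f r < x)" (is "hoare M _ ?c ?R") for x
  proof (rule hoare_local)
    fix k r mm assume "J k r mm \<and> r 9 \<noteq> 0 \<and> f r = x"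
    then obtain h Ref B qs where *: "algorithm_inv Ref B qs" "handled Ref qs h" "ctx0 h Ref B qs r mm"
      "h < length qs" "k \<le> T h Ref" and x: "f r = x" unfolding J_def by auto
    obtain t p' where tp': "qs ! h = (t, p')" by fastforce
    have t: "t < m" using inv_bounds(4)[OF *(1)] *(4) tp' nth_mem[of h qs] by auto
    have len: "length qs \<le> m * (nQ + 1)" using inv_bounds(3)[OF *(1)] .
    have x': "x = base_Q + 2 * (m * (nQ + 1)) - (base_Q + 2 * h)"
      using x ctx0D(12)[OF *(3)] by (simp add: f_def)
    define K where "K = 60 + 20 * m + 200 * (m + 1) * h"
    let ?P = "\<lambda>k r mm. k \<le> T h Ref \<and> ctx0 h Ref B qs r mm"
    let ?Q1 = "\<lambda>k r mm. \<exists>Ref B qs. algorithm_inv Ref B qs \<and> handled Ref qs h \<and> h < length qs \<and> qs ! h = (t, p') \<and>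
       k \<le> K + 100 * (m + 1) * card Ref \<and> ctx (Suc h) t p' (r 15) Ref B qs r mm"
    let ?Q2 = "\<lambda>k r mm. \<exists>Ref B qs. algorithm_inv Ref B qs \<and> handled Ref qs (Suc h) \<and> h < length qs \<and>
       k \<le> K + 70 * m + 10 + 100 * (m + 1) * card Ref \<and> ctx0 (Suc h) Ref B qs r mm"
    have "hoare M ?P ?c ?R"
    proof (rule hoare_block_seq[OF _ hoare_seq_block[OF pop_code_correct[OF t, of h p' K]]])
      fix k r mm assume P: "?P k r mm"
      then have c: "ctx0 h Ref B qs r mm" and k: "k \<le> T h Ref" by auto
      note mem = mem_repD(10,11)[OF ctx0D(13)[OF c] *(4), unfolded tp' fst_conv snd_conv]
        mem_repD(4-7)[OF ctx0D(13)[OF c] t]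
      have c': "ctx0 (Suc h) Ref B qs (r(10 := t, 11 := p', 8 := Suc (Suc (base_Q + 2 * h)))) mm"
        using c by (simp add: ctx0_def const_regs_def)
      have "base_Q + 2 * h + 2 \<le> M"
        using address_bounds(4)[of h] *(4) len by simp
      moreover have "Suc (Suc (Suc (Suc (Suc (Suc (Suc (Suc (Suc (Suc (Suc (Suc (Suc k))))))))))))
          \<le> K + 100 * (m + 1) * card Ref"
        using k by (simp add: K_def T_def)
      ultimately show "wp M ?B1 ?Q1 k r mm"
        using address_bounds(1)[OF t] * tp' c'
        by (simp add: load_field_def ctx0D(1-12)[OF c] mem ctx_iff) blast
    next
      fix k r mm assume "?Q2 k r mm"
      then obtain Ref B qs where q: "algorithm_inv Ref B qs" "handled Ref qs (Suc h)" "h < length qs"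
        "k \<le> K + 70 * m + 10 + 100 * (m + 1) * card Ref" and c: "ctx0 (Suc h) Ref B qs r mm"
        by blast
      have "J (Suc (k + 2)) (r(9 := 2 * length qs - 2 * Suc h)) mm"
        unfolding J_def using q c
        by (intro exI[of _ "Suc h"] exI[of _ Ref] exI[of _ B] exI[of _ qs])
          (simp add: K_def T_def)
      moreover have "f (r(9 := 2 * length qs - 2 * Suc h)) < x"
        using q(3) inv_bounds(3)[OF q(1)] ctx0D(12)[OF c] x' by (simp add: f_def)
      moreover have "base_Q + 2 * length qs - (base_Q + 2 * Suc h) = 2 * length qs - 2 * Suc h"
        by simp
      ultimately show "wp M [Sub 9 7 8] ?R k r mm"
        unfolding wp.simps ctx0D(11,12)[OF c] by (simp only: add_Suc)
    qed
    then show "\<exists>P'. P' k r mm \<and> hoare M P' ?c ?R"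
      using *(3,5) by (intro exI[of _ ?P] conjI)
  qed
  show ?thesis
    unfolding main_code_def
  proof (rule hoare_seq[OF init_code_correct hoare_seq[OF fill_code_correct
          hoare_block_seq[OF _ hoare_seq_block[OF hoare_while[where f = "\<lambda>r mm. f r", OF body]]]]])
    fix k r mm
    assume *: "k \<le> 30 + 20 * m \<and> ctx0 0 {} {} (map (\<lambda>u. (u, nQ)) [0..<m]) r mm"
    have "handled {} (map (\<lambda>u. (u, nQ)) [0..<m]) 0" by (simp add: handled_def)
    then have "J (Suc (Suc k)) (r(9 := 2 * m)) mm"
      unfolding J_def using * inv_init
      by (intro exI[of _ 0] exI[of _ "{}"] exI[of _ "map (\<lambda>u. (u, nQ)) [0..<m]"]) (simp add: T_def)
    then show "wp M [Sub 9 7 8] (\<lambda>k r mm. J (Suc k) r mm) k r mm"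
      using * ctx0D(11,12)[of 0 "{}" "{}" "map (\<lambda>u. (u, nQ)) [0..<m]" r mm] by simp
  next
    fix k r mm assume "J k r mm \<and> r 9 = 0"
    then obtain h Ref B qs where *: "algorithm_inv Ref B qs" "handled Ref qs h" "ctx0 h Ref B qs r mm"
      "length qs \<le> h" "k \<le> T h Ref" unfolding J_def by auto
    have h: "h = length qs" using *(2,4) by (simp add: handled_def)
    let ?b = "\<exists>R \<subseteq> {..<nQ} \<times> {..<nQ}. simulates R \<and> (i0, i0) \<in> R"
    have res: "(i0, i0) \<notin> B \<longleftrightarrow> ?b"
      using result_correct[OF *(1)] *(2) h by simp
    have "(m + 1) * h \<le> (m + 1) * ((m + 1) * (nQ + 1))"
      using inv_bounds(3)[OF *(1)] h by (intro mult_le_mono2) simp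
    moreover have "(m + 1) * card Ref \<le> (m + 1) * ((m + 1) * (nQ + 1))"
      using inv_bounds(2)[OF *(1)] by (intro mult_le_mono2) simp
    moreover have "m + 1 \<le> (m + 1) * ((m + 1) * (nQ + 1))"
      by simp
    moreover have "k \<le> 40 + 20 * m + 200 * ((m + 1) * h) + 100 * ((m + 1) * card Ref)"
      using *(5) by (simp only: T_def mult.assoc)
    \<comment> \<open>Seven is the length of the final block that reads the answer.\<close>
    moreover have "k + 7 \<le> 400 * X"
      if "y \<le> X" "z \<le> X" "m + 1 \<le> X" "k \<le> 40 + 20 * m + 200 * y + 100 * z" for X y z
      using that by linarith
    ultimately have "k + 7 \<le> 400 * ((m + 1) * ((m + 1) * (nQ + 1)))" by blast
    then show "wp M ?B2 (\<lambda>k r mm. k \<le> 400 * ((m + 1) * ((m + 1) * (nQ + 1))) \<and>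
        r 0 = of_bool (\<exists>R \<subseteq> {..<nQ} \<times> {..<nQ}. simulates R \<and> (i0, i0) \<in> R)) k r mm"
      unfolding res[symmetric] using address_bounds(3)[OF init init] address_bounds(5)
      by (simp add: ctx0D(1-12)[OF *(3)] mem_repD(2)[OF ctx0D(13)[OF *(3)]]
          mem_repD(9)[OF ctx0D(13)[OF *(3)] init init])
  qed
qed

end

section \<open>Encoded automata\<close>

locale encoded_automaton =
  fixes A :: "('a, 's) automaton" and f :: "'s \<Rightarrow> nat" and g :: "'a \<Rightarrow> nat"
    and ts :: "('a, 's) transition list"
  assumes A: "automaton A"
    and weights: "\<And>t. t \<in> transitions A \<Longrightarrow> weight t \<in> {0, 1}"
    and f: "bij_betw f (states A) {..<card (states A)}"
    and g: "bij_betw g (alphabet A) {..<card (alphabet A)}"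
    and ts: "distinct ts" "set ts = transitions A"
begin

abbreviation "src k \<equiv> f (source (ts ! k))"
abbreviation "lt k \<equiv> g (letter (ts ! k))"
abbreviation "wt k \<equiv> (if weight (ts ! k) = 1 then 1 else 0 :: nat)"
abbreviation "tgt k \<equiv> f (target (ts ! k))"

lemma ts_nth: "k < length ts \<Longrightarrow> ts ! k \<in> transitions A"
  using ts(2) nth_mem by blast

lemma f_less: "q \<in> states A \<Longrightarrow> f q < card (states A)"
  using bij_betwE[OF f] by auto

lemma g_less: "a \<in> alphabet A \<Longrightarrow> g a < card (alphabet A)"
  using bij_betwE[OF g] by auto

lemma f_eq_iff: "q \<in> states A \<Longrightarrow> p \<in> states A \<Longrightarrow> f q = f p \<longleftrightarrow> q = p"
  using inj_on_eq_iff[OF bij_betw_imp_inj_on[OF f]] .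

lemma g_eq_iff: "a \<in> alphabet A \<Longrightarrow> b \<in> alphabet A \<Longrightarrow> g a = g b \<longleftrightarrow> a = b"
  using inj_on_eq_iff[OF bij_betw_imp_inj_on[OF g]] .

lemma f_surj: "i < card (states A) \<Longrightarrow> \<exists>q\<in>states A. f q = i"
  using bij_betw_imp_surj_on[OF f] by (metis imageE lessThan_iff)

lemma g_surj: "i < card (alphabet A) \<Longrightarrow> \<exists>a\<in>alphabet A. g a = i"
  using bij_betw_imp_surj_on[OF g] by (metis imageE lessThan_iff)

lemma init_in: "init A \<in> states A"
  using A by (simp add: automaton_def)

lemma length_ts: "length ts = card (transitions A)"
  using distinct_card[OF ts(1)] ts(2) by simp

lemma Bex_transitions: "(\<exists>t\<in>transitions A. \<Phi> t) \<longleftrightarrow> (\<exists>k<length ts. \<Phi> (ts ! k))"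
  unfolding ts(2)[symmetric] by (metis in_set_conv_nth)

lemma Ball_transitions: "(\<forall>t\<in>transitions A. \<Phi> t) \<longleftrightarrow> (\<forall>k<length ts. \<Phi> (ts ! k))"
  unfolding ts(2)[symmetric] by (metis in_set_conv_nth)

sublocale game_instance "length ts" "card (states A)" "card (alphabet A)" "f (init A)" src lt wt tgt
proof
  fix q a assume "q < card (states A)" "a < card (alphabet A)"
  then obtain q' a' where "q' \<in> states A" "f q' = q" "a' \<in> alphabet A" "g a' = a"
    using f_surj g_surj by metis
  then show "\<exists>t<length ts. src t = q \<and> lt t = a"
    using transition_exists[OF A, of q' a'] unfolding Bex_transitions by auto
qed (use transitions_closed[OF A] ts_nth f_less g_less init_in in auto)

text \<open>One step of the game is transferred for an arbitrary condition \<open>Z\<close> on the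
  targets, so that both directions of the translation between relations can use it.\<close>

lemma step_iff:
  assumes qp: "q \<in> states A" "p \<in> states A" and a: "a \<in> alphabet A"
    and Z: "\<And>x y. x \<in> states A \<Longrightarrow> y \<in> states A \<Longrightarrow> Z x y \<longleftrightarrow> Z' (f x) (f y)"
  shows "(\<exists>t\<in>transitions A. source t = q \<and> letter t = a \<and>
       (\<forall>u\<in>transitions A. source u = p \<and> letter u = a \<longrightarrow>
          weight u \<le> weight t \<and> Z (target t) (target u))) \<longleftrightarrow>
     (\<exists>t<length ts. src t = f q \<and> lt t = g a \<and>
       (\<forall>u<length ts. src u = f p \<and> lt u = g a \<longrightarrow> wt u \<le> wt t \<and> Z' (tgt t) (tgt u)))"
proof -
  \<comment> \<open>With weights restricted to {0, 1}, the encoding by a test for 1 preserves their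
    order.\<close>
  have w: "weight u \<le> weight t \<longleftrightarrow> (if weight u = 1 then 1 else 0 :: nat) \<le> (if weight t = 1 then 1 else 0)"
    if "u \<in> transitions A" "t \<in> transitions A" for t u
    using weights[OF that(1)] weights[OF that(2)] by auto
  have inner: "(source (ts ! u) = p \<and> letter (ts ! u) = a \<longrightarrow>
      weight (ts ! u) \<le> weight (ts ! t) \<and> Z (target (ts ! t)) (target (ts ! u))) \<longleftrightarrow>
    (src u = f p \<and> lt u = g a \<longrightarrow> wt u \<le> wt t \<and> Z' (tgt t) (tgt u))"
    if "t < length ts" "u < length ts" for t u
    using transitions_closed[OF A ts_nth[OF that(1)]] transitions_closed[OF A ts_nth[OF that(2)]]
      qp a Z f_eq_iff g_eq_iff w[OF ts_nth[OF that(2)] ts_nth[OF that(1)]]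
    by (simp only:)
  have outer: "source (ts ! t) = q \<and> letter (ts ! t) = a \<longleftrightarrow> src t = f q \<and> lt t = g a"
    if "t < length ts" for t
    using transitions_closed[OF A ts_nth[OF that]] qp a f_eq_iff g_eq_iff by (simp only:)
  show ?thesis
    unfolding Bex_transitions Ball_transitions
    using inner outer by (intro ex_cong1) (auto simp only: conj_assoc[symmetric])
qed

lemma relation_iff:
  "(\<exists>R \<subseteq> states A \<times> states A. one_token_relation A R \<and> (init A, init A) \<in> R) \<longleftrightarrow>
   (\<exists>R \<subseteq> {..<card (states A)} \<times> {..<card (states A)}. simulates R \<and> (f (init A), f (init A)) \<in> R)"
proof
  assume "\<exists>R \<subseteq> states A \<times> states A. one_token_relation A R \<and> (init A, init A) \<in> R"
  then obtain R where R: "R \<subseteq> states A \<times> states A" "one_token_relation A R" "(init A, init A) \<in> R"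
    by blast
  define R' where "R' = (\<lambda>(q, p). (f q, f p)) ` R"
  have mem: "(q, p) \<in> R \<longleftrightarrow> (f q, f p) \<in> R'" if "q \<in> states A" "p \<in> states A" for q p
  proof
    assume "(f q, f p) \<in> R'"
    then obtain q' p' where *: "(q', p') \<in> R" "f q = f q'" "f p = f p'"
      by (auto simp: R'_def)
    then have "q' \<in> states A" "p' \<in> states A" using R(1) by auto
    then show "(q, p) \<in> R" using * that f_eq_iff by simp
  qed (force simp: R'_def)
  have "simulates R'"
    unfolding simulates_def
  proof (intro allI impI)
    fix q p a assume "(q, p) \<in> R'" "a < card (alphabet A)"
    then obtain q' p' where qp: "(q', p') \<in> R" "q = f q'" "p = f p'"
      by (auto simp: R'_def)
    obtain a' where a: "a' \<in> alphabet A" "a = g a'"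
      using g_surj[OF \<open>a < card (alphabet A)\<close>] by auto
    have S: "q' \<in> states A" "p' \<in> states A" using qp(1) R(1) by auto
    show "\<exists>t<length ts. src t = q \<and> lt t = a \<and>
       (\<forall>u<length ts. src u = p \<and> lt u = a \<longrightarrow> wt u \<le> wt t \<and> (tgt t, tgt u) \<in> R')"
      using R(2)[unfolded one_token_relation_def, rule_format, OF qp(1)] a(1)
        step_iff[OF S a(1), of "\<lambda>x y. (x, y) \<in> R" "\<lambda>x y. (x, y) \<in> R'"] mem
      unfolding qp(2,3) a(2) by simp
  qed
  moreover have "R' \<subseteq> {..<card (states A)} \<times> {..<card (states A)}"
    using R(1) f_less by (auto simp: R'_def)
  moreover have "(f (init A), f (init A)) \<in> R'" using R(3) by (force simp: R'_def)
  ultimately show "\<exists>R \<subseteq> {..<card (states A)} \<times> {..<card (states A)}.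
      simulates R \<and> (f (init A), f (init A)) \<in> R" by blast
next
  assume "\<exists>R \<subseteq> {..<card (states A)} \<times> {..<card (states A)}.
      simulates R \<and> (f (init A), f (init A)) \<in> R"
  then obtain R' where R': "simulates R'" "(f (init A), f (init A)) \<in> R'" by blast
  define R where "R = {(q, p). q \<in> states A \<and> p \<in> states A \<and> (f q, f p) \<in> R'}"
  have "one_token_relation A R"
    unfolding one_token_relation_def
  proof safe
    fix q p a assume "(q, p) \<in> R" and a: "a \<in> alphabet A"
    then have S: "q \<in> states A" "p \<in> states A" and qp: "(f q, f p) \<in> R'" by (auto simp: R_def)
    show "\<exists>t\<in>transitions A. source t = q \<and> letter t = a \<and>
       (\<forall>u\<in>transitions A. source u = p \<and> letter u = a \<longrightarrow>
          weight u \<le> weight t \<and> (target t, target u) \<in> R)"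
      using R'(1)[unfolded simulates_def, rule_format, OF qp g_less[OF a]]
        step_iff[OF S a, of "\<lambda>x y. (x, y) \<in> R" "\<lambda>x y. (x, y) \<in> R'"]
      by (simp add: R_def)
  qed
  then show "\<exists>R \<subseteq> states A \<times> states A. one_token_relation A R \<and> (init A, init A) \<in> R"
    using R'(2) init_in by (intro exI[of _ R]) (auto simp: R_def)
qed

section \<open>From the encoding to the running machine\<close>

definition input :: "nat list" where
  "input = [card (alphabet A), card (states A), f (init A), length ts]
             @ concat (map (encode_transition f g) ts)"

lemma length_input: "length input = 4 * length ts + 4"
proof -
  have "length (concat (map (encode_transition f g) us)) = 4 * length us" for us
    by (induction us) (simp_all add: encode_transition_def)
  then show ?thesis by (simp add: input_def)
qed

lemma nth_input:
  assumes "k < length ts" "i < 4"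
  shows "input ! (k * 4 + (4 + i)) = encode_transition f g (ts ! k) ! i"
proof -
  have "concat (map (encode_transition f g) us) ! (k * 4 + i) = encode_transition f g (us ! k) ! i"
    if "k < length us" for us k
    using that
  proof (induction us arbitrary: k)
    case (Cons u us)
    have "length (encode_transition f g u) = 4" by (simp add: encode_transition_def)
    then show ?case using Cons assms(2) by (cases k) (simp_all add: nth_append)
  qed simp
  from this[OF assms(1)] show ?thesis
    unfolding input_def by (simp add: nth_append)
qed

lemma mem_rep_initial: "mem_rep {} {} [] (mem (initial_config input))"
proof -
  have zero: "mem (initial_config input) i = 0" if "base_R \<le> i" for i
    using that by (simp add: initial_config_def length_input base_R_def)
  have entry: "mem (initial_config input) (k * 4 + (4 + i)) = encode_transition f g (ts ! k) ! i"
    if "k < length ts" "i < 4" for k i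
    using that nth_input[OF that] by (simp add: initial_config_def length_input)
  have "mem (initial_config input) (Suc 0) = card (states A)"
    "mem (initial_config input) 2 = f (init A)" "mem (initial_config input) 3 = length ts"
    by (simp_all add: initial_config_def length_input) (simp_all add: input_def)
  moreover have "mem (initial_config input) (k * 4 + 4) = src k"
    "mem (initial_config input) (k * 4 + 5) = lt k"
    "mem (initial_config input) (k * 4 + 6) = wt k"
    "mem (initial_config input) (k * 4 + 7) = tgt k" if "k < length ts" for k
    using entry[OF that, of 0] entry[OF that, of 1] entry[OF that, of 2] entry[OF that, of 3]
    by (simp_all add: encode_transition_def)
  ultimately show ?thesis
    using zero by (simp add: mem_rep_def base_B_def)
qed

lemma size_bounds:
  "length ts \<le> automaton_size A" "card (states A) \<le> automaton_size A"
  "card (alphabet A) \<le> automaton_size A" "1 \<le> automaton_size A"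
proof -
  show S: "card (states A) \<le> automaton_size A" by (simp add: automaton_size_def)
  have "card (states A) \<noteq> 0" using A init_in by (auto simp: automaton_def)
  with S show "1 \<le> automaton_size A" by linarith
qed (simp_all add: automaton_size_def length_ts)

text \<open>The bound on numbers is required of all configurations, including the initial one, whose
  memory holds the input.\<close>

lemma input_le:
  assumes "x \<in> set input"
  shows "x \<le> automaton_size A"
proof -
  note closed = transitions_closed[OF A, folded ts(2)]
  have "x \<in> {card (alphabet A), card (states A), f (init A), length ts} \<or>
      (\<exists>t\<in>set ts. x \<in> {f (source t), g (letter t), 0, 1, f (target t)})"
    using assms by (auto simp: input_def encode_transition_def split: if_splits)
  moreover have "f (source t) \<le> automaton_size A" "f (target t) \<le> automaton_size A"
    "g (letter t) \<le> automaton_size A" if "t \<in> set ts" for t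
    using f_less[OF closed(1)[OF that]] f_less[OF closed(3)[OF that]] g_less[OF closed(2)[OF that]]
      size_bounds by linarith+
  moreover have "f (init A) \<le> automaton_size A"
    using f_less[OF init_in] size_bounds by linarith
  ultimately show ?thesis using size_bounds by auto
qed

text \<open>A far smaller factor would do here. The value 3200 comes from the time bound, because
  \<open>decidable_in_time\<close> uses one constant for both time and numbers.\<close>

lemma bounded_instance:
  "bounded_game_instance (length ts) (card (states A)) (card (alphabet A)) (f (init A)) src lt wt tgt
     (3200 * automaton_size A ^ 2)"
proof
  define n where "n = automaton_size A"
  define m where "m = length ts"
  define k where "k = card (states A)"
  have b: "m \<le> n" "k \<le> n" "card (alphabet A) \<le> n" "1 \<le> n"
    using size_bounds by (simp_all add: n_def m_def k_def)
  have "m * k \<le> n * n" "k * k \<le> n * n" using b by (simp_all add: mult_le_mono)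
  moreover have "n * 1 \<le> n * n" using b by (intro mult_le_mono2)
  ultimately have "4 * m + 4 + m * k + k * k + 2 * (m * k) + 4 * m + 2 * card (alphabet A) + 2 * k + 20
      \<le> 3200 * (n * n)"
    using b by linarith
  then show "base_Q + 2 * (length ts * (card (states A) + 2)) + 2 * card (alphabet A) +
      2 * card (states A) + 20 \<le> 3200 * (automaton_size A)\<^sup>2"
    unfolding base_R_def base_B_def base_Q_def
    by (simp add: n_def m_def k_def power2_eq_square algebra_simps)
qed

theorem main_code_decides:
  fixes P :: program
  defines "P \<equiv> compile 0 main_code"
  defines "accept \<equiv> \<exists>R \<subseteq> {..<card (states A)} \<times> {..<card (states A)}.
    simulates R \<and> (f (init A), f (init A)) \<in> R"
  shows "\<exists>t \<le> 3200 * automaton_size A ^ 3. halted P (config_after P input t) \<and>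
      regs (config_after P input t) 0 = (if accept then 1 else 0)"
    and "regs (config_after P input t) i \<le> 3200 * automaton_size A ^ 2 \<and>
      mem (config_after P input t) i \<le> 3200 * automaton_size A ^ 2"
proof -
  define n where "n = automaton_size A"
  let ?M = "3200 * n ^ 2"
  let ?s = "initial_config input"
  interpret bounded_game_instance "length ts" "card (states A)" "card (alphabet A)" "f (init A)"
    src lt wt tgt "?M"
    using bounded_instance by (simp add: n_def)
  have b: "length ts \<le> n" "card (states A) \<le> n" "1 \<le> n"
    using size_bounds by (simp_all add: n_def)
  have n: "n \<le> ?M" using b by (simp add: power2_eq_square)
  have init_bounded: "bounded_by ?M ?s"
    unfolding bounded_by_def
  proof (intro allI conjI)
    fix i
    show "regs ?s i \<le> ?M" by (simp add: initial_config_def)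
    show "mem ?s i \<le> ?M"
      using input_le[OF nth_mem, of i] n by (auto simp: initial_config_def n_def)
  qed
  have "P = [] @ compile (length ([] :: program)) main_code @ []" by (simp add: P_def)
  from hoareE[OF main_code_correct this _ init_bounded, of 0] mem_rep_initial
  obtain N where N: "pc ((step P ^^ N) ?s) = length ([] :: program) + csize main_code"
    "0 + N \<le> 400 * ((length ts + 1) * ((length ts + 1) * (card (states A) + 1))) \<and>
       regs ((step P ^^ N) ?s) 0 = of_bool accept"
    "\<And>j. j \<le> N \<Longrightarrow> bounded_by ?M ((step P ^^ j) ?s)"
    unfolding accept_def by (auto simp: initial_config_def)
  \<comment> \<open>As the size is at least 1, each factor at most doubles; the resulting 8 times
    the factor 400 of the time bound gives 3200.\<close>
  have "(length ts + 1) * ((length ts + 1) * (card (states A) + 1)) \<le> (2 * n) * ((2 * n) * (2 * n))"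
    using b by (intro mult_le_mono) simp_all
  then have time: "N \<le> 3200 * n ^ 3" using N(2) by (simp add: power3_eq_cube)
  have halt: "halted P ((step P ^^ N) ?s)" using N(1) by (simp add: halted_def P_def)
  show "\<exists>t \<le> 3200 * automaton_size A ^ 3. halted P (config_after P input t) \<and>
      regs (config_after P input t) 0 = (if accept then 1 else 0)"
    using time halt N(2) by (intro exI[of _ N]) (simp add: config_after_def n_def)
  have "bounded_by ?M ((step P ^^ t) ?s)"
  proof (cases "t \<le> N")
    case False
    \<comment> \<open>A halted configuration no longer changes, so the bound extends from the first
      \<open>N\<close> steps to all times.\<close>
    have "step P ((step P ^^ N) ?s) = (step P ^^ N) ?s"
      using halt by (simp only: step_def[of P "(step P ^^ N) ?s"] if_True)
    then have "(step P ^^ (d + N)) ?s = (step P ^^ N) ?s" for d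
      by (induction d) simp_all
    from this[of "t - N"] show ?thesis using N(3)[of N] False by simp
  qed (rule N(3))
  then show "regs (config_after P input t) i \<le> 3200 * automaton_size A ^ 2 \<and>
      mem (config_after P input t) i \<le> 3200 * automaton_size A ^ 2"
    by (simp add: bounded_by_def config_after_def n_def)
qed

end

text \<open>Reachability and safety enter only through the assumption that a run's value is its last
  weight. The program and the constants 3200 and 2 are the same for all instances.\<close>

lemma absorbing_decidable:
  fixes Inst :: "('a, 's) automaton \<Rightarrow> bool"
  assumes absorbing: "\<And>A. Inst A \<Longrightarrow> absorbing_automaton b A"
    and Val: "\<And>A w \<rho>. Inst A \<Longrightarrow> is_run A w \<rho> \<Longrightarrow> \<rho> \<noteq> [] \<Longrightarrow>
      run_value Val \<rho> = real_of_rat (weight (last \<rho>))"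
  shows "decidable_in_time Inst encodes automaton_size (history_deterministic Val) (\<lambda>n. n ^ 3)"
  unfolding decidable_in_time_def
proof (intro exI allI impI)
  fix A :: "('a, 's) automaton" and xs
  assume inst: "Inst A" and "encodes A xs"
  then obtain f g ts where enc: "bij_betw f (states A) {..<card (states A)}"
    "bij_betw g (alphabet A) {..<card (alphabet A)}" "distinct ts" "set ts = transitions A"
    and xs: "xs = [card (alphabet A), card (states A), f (init A), length ts]
               @ concat (map (encode_transition f g) ts)"
    unfolding encodes_def by blast
  have A: "automaton A" and weights: "\<And>t. t \<in> transitions A \<Longrightarrow> weight t \<in> {0, 1}"
    using absorbing[OF inst] by (simp_all add: absorbing_automaton_def)
  interpret encoded_automaton A f g ts
    using A weights enc by unfold_locales
  have "history_deterministic Val A \<longleftrightarrow>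
      (\<exists>R \<subseteq> {..<card (states A)} \<times> {..<card (states A)}. simulates R \<and> (f (init A), f (init A)) \<in> R)"
    using history_deterministic_iff[OF A weights Val[OF inst]] relation_iff by simp
  then show "(\<exists>t \<le> 3200 * automaton_size A ^ 3.
        halted (compile 0 main_code) (config_after (compile 0 main_code) xs t) \<and>
        regs (config_after (compile 0 main_code) xs t) 0 = (if history_deterministic Val A then 1 else 0)) \<and>
      (\<forall>t r. regs (config_after (compile 0 main_code) xs t) r \<le> 3200 * automaton_size A ^ 2 \<and>
        mem (config_after (compile 0 main_code) xs t) r \<le> 3200 * automaton_size A ^ 2)"
    using main_code_decides unfolding xs input_def[symmetric] by simp
qed

theorem theorem4p10:
  shows "decidable_in_time
           (reachability_automaton :: ('a, 's) automaton \<Rightarrow> bool)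
           encodes automaton_size (history_deterministic sup_value) (\<lambda>n. n ^ 3)
       \<and> decidable_in_time
           (safety_automaton :: ('a, 's) automaton \<Rightarrow> bool)
           encodes automaton_size (history_deterministic inf_value) (\<lambda>n. n ^ 3)"
proof
  show "decidable_in_time (reachability_automaton :: ('a, 's) automaton \<Rightarrow> bool)
      encodes automaton_size (history_deterministic sup_value) (\<lambda>n. n ^ 3)"
    by (rule absorbing_decidable[where b = 1])
      (auto simp: reachability_automaton_def run_value_last_sup)
  show "decidable_in_time (safety_automaton :: ('a, 's) automaton \<Rightarrow> bool)
      encodes automaton_size (history_deterministic inf_value) (\<lambda>n. n ^ 3)"
    by (rule absorbing_decidable[where b = 0])
      (auto simp: safety_automaton_def run_value_last_inf)
qed

end
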